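(* Let $\mathcal{R}$ be an ordered binary structure of type $k$. If $\mathcal{R}$ has a monomorphic decomposition into finitely many blocks, then the profile of its age $\mathrm{Age}(\mathcal{R})$ coincides, for all sufficiently large $n$, with a polynomial; otherwise this profile is at least exponential, i.e. there exist $a>0$ and $c>1$ with $\varphi(n)\ge a c^n$ for all sufficiently large $n$.
   Context: An ordered binary structure of type $k$ is $\mathcal{R}=(E,\le,\rho_1,\dots,\rho_k)$ with $\le$ a linear order and $\rho_i$ binary relations on $E$. $\mathrm{Age}(\mathcal{R})$ is the class of finite restrictions of $\mathcal{R}$ up to isomorphism, and its profile $\varphi(n)$ is the number of members with $n$ elements. A monomorphic decomposition of $\mathcal{R}$ is a partition $\mathcal{P}$ of $E$ such that for all finite $A,A'\subseteq E$ with $|A\cap B|=|A'\cap B|$ for every $B\in\mathcal{P}$, $\mathcal{R}_{\restriction A}\cong\mathcal{R}_{\restriction A'}$. *)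

theory Defs
  imports Complex_Main "HOL-Library.Disjoint_Sets" "HOL-Computational_Algebra.Polynomial"
begin

record 'a binary_structure =
  base :: "'a set"
  leq :: "'a rel"
  rels :: "'a rel list"

definition ordered_binary_structure :: "nat \<Rightarrow> 'a binary_structure \<Rightarrow> bool" where
  "ordered_binary_structure k R \<longleftrightarrow>
     linear_order_on (base R) (leq R) \<and>
     length (rels R) = k \<and>
     (\<forall>r \<in> set (rels R). r \<subseteq> base R \<times> base R)"

definition restriction :: "'a binary_structure \<Rightarrow> 'a set \<Rightarrow> 'a binary_structure" where
  "restriction R A =
     \<lparr>base = base R \<inter> A,
      leq = leq R \<inter> A \<times> A,
      rels = map (\<lambda>r. r \<inter> A \<times> A) (rels R)\<rparr>"

definition isomorphic :: "'a binary_structure \<Rightarrow> 'b binary_structure \<Rightarrow> bool" where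
  "isomorphic S T \<longleftrightarrow>
     length (rels S) = length (rels T) \<and>
     (\<exists>f. bij_betw f (base S) (base T) \<and>
       (\<forall>x \<in> base S. \<forall>y \<in> base S.
          ((x, y) \<in> leq S \<longleftrightarrow> (f x, f y) \<in> leq T) \<and>
          (\<forall>i < length (rels S). (x, y) \<in> rels S ! i \<longleftrightarrow> (f x, f y) \<in> rels T ! i)))"

definition finite_restrictions :: "'a binary_structure \<Rightarrow> 'a binary_structure set" where
  "finite_restrictions R = {restriction R A | A. finite A \<and> A \<subseteq> base R}"

(* "Up to isomorphism" is rendered by taking isomorphism classes: a member of the age is
   the class of all finite restrictions of R isomorphic to a given one. *)
definition age :: "'a binary_structure \<Rightarrow> 'a binary_structure set set" where
  "age R = finite_restrictions R //
     {(S, T). S \<in> finite_restrictions R \<and> T \<in> finite_restrictions R \<and> isomorphic S T}"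

(* The set counted here is always finite: on n points there are at most 2^((k+1) n^2)
   structures of type k up to isomorphism.  All structures in a class C have bases of the
   same cardinality, so the quantifier over C could equally be existential. *)
definition profile :: "'a binary_structure \<Rightarrow> nat \<Rightarrow> nat" where
  "profile R n = card {C \<in> age R. \<forall>S \<in> C. card (base S) = n}"

definition monomorphic_decomposition :: "'a binary_structure \<Rightarrow> 'a set set \<Rightarrow> bool" where
  "monomorphic_decomposition R P \<longleftrightarrow>
     partition_on (base R) P \<and>
     (\<forall>A A'. finite A \<longrightarrow> finite A' \<longrightarrow> A \<subseteq> base R \<longrightarrow> A' \<subseteq> base R \<longrightarrow>
        (\<forall>B \<in> P. card (A \<inter> B) = card (A' \<inter> B)) \<longrightarrow>
        isomorphic (restriction R A) (restriction R A'))"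

end

theory Submission
  imports Defs "HOL-Library.Ramsey" "HOL-Library.Multiset" "HOL-Library.FuncSet"
begin

text \<open>
  Call \<open>p < q\<close> separated if some \<open>z\<close> outside \<open>[p, q]\<close> is related differently to \<open>p\<close> and \<open>q\<close>, and
  call two points twins if the interval between them contains no separated pair.  This is an
  equivalence relation with convex classes.

  If there are infinitely many classes, there is a monotone sequence of pairwise disjoint separated
  pairs with witnesses.  By Ramsey's theorem it may be assumed uniform, and then choosing,
  independently in each of \<open>n div 3\<close> places, either a separated pair or two points that are not
  separated yields \<open>2 ^ (n div 3)\<close> pairwise nonisomorphic restrictions with \<open>n\<close> elements.

  If there are finitely many classes, they form a monomorphic decomposition (when the base is
  infinite), and the restriction to a finite set is described by the sorted word of the classes of
  its elements.  Among the words describing isomorphic restrictions select the lexicographically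
  least one.  Whether a word is selected depends only on its letter counts truncated at some
  threshold, so the number of selected words of length \<open>n\<close> is eventually a polynomial in \<open>n\<close>.

  Finally, a monomorphic decomposition into \<open>d\<close> blocks bounds the profile by \<open>(n + 1) ^ d\<close>, which
  rules out the first case.  So no structure theory of arbitrary monomorphic decompositions is needed.
\<close>

section \<open>Eventually polynomial functions\<close>

definition eventually_poly :: "(nat \<Rightarrow> nat) \<Rightarrow> bool" where
  "eventually_poly f \<longleftrightarrow> (\<exists>p :: real poly. \<forall>\<^sub>F n in sequentially. real (f n) = poly p (real n))"

lemma eventually_polyI:
  assumes "\<And>n. n \<ge> N \<Longrightarrow> real (f n) = poly p (real n)"
  shows "eventually_poly f"
  unfolding eventually_poly_def eventually_sequentially using assms by blast

lemma eventually_polyE: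
  assumes "eventually_poly f"
  obtains p N where "\<And>n. n \<ge> N \<Longrightarrow> real (f n) = poly p (real n)"
  using assms unfolding eventually_poly_def eventually_sequentially by blast

lemma eventually_poly_cong:
  assumes "eventually_poly f" "\<And>n. n \<ge> N \<Longrightarrow> g n = f n"
  shows "eventually_poly g"
proof -
  obtain p N' where "\<And>n. n \<ge> N' \<Longrightarrow> real (f n) = poly p (real n)"
    using assms(1) by (rule eventually_polyE) blast
  then show ?thesis
    using assms(2) by (intro eventually_polyI[of "max N N'" g p]) simp
qed

lemma eventually_poly_add:
  assumes "eventually_poly f" "eventually_poly g"
  shows "eventually_poly (\<lambda>n. f n + g n)"
proof -
  obtain p N where "\<And>n. n \<ge> N \<Longrightarrow> real (f n) = poly p (real n)"
    using assms(1) by (rule eventually_polyE) blast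
  moreover obtain q N' where "\<And>n. n \<ge> N' \<Longrightarrow> real (g n) = poly q (real n)"
    using assms(2) by (rule eventually_polyE) blast
  ultimately show ?thesis
    by (intro eventually_polyI[of "max N N'" _ "p + q"]) simp
qed

lemma eventually_poly_sum:
  assumes "finite S" "\<And>s. s \<in> S \<Longrightarrow> eventually_poly (f s)"
  shows "eventually_poly (\<lambda>n. \<Sum>s\<in>S. f s n)"
  using assms
proof (induction S rule: finite_induct)
  case empty
  show ?case by (rule eventually_polyI[of 0 _ 0]) simp
qed (simp add: eventually_poly_add)

lemma eventually_poly_shift:
  assumes "eventually_poly f"
  shows "eventually_poly (\<lambda>n. if t \<le> n then f (n - t) else 0)"
proof -
  obtain p N where "\<And>n. n \<ge> N \<Longrightarrow> real (f n) = poly p (real n)"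
    using assms by (rule eventually_polyE) blast
  then show ?thesis
    by (intro eventually_polyI[of "N + t" _ "pcompose p [:- real t, 1:]"])
      (simp add: poly_pcompose of_nat_diff)
qed

text \<open>Telescoping \<open>(s + 1) ^ (k + 1) - s ^ (k + 1)\<close> and expanding by the binomial
  theorem expresses the \<open>k\<close>-th power sum through the lower ones.\<close>

lemma power_sum_poly: "\<exists>P :: real poly. \<forall>n. (\<Sum>s<n. real s ^ k) = poly P (real n)"
proof (induction k rule: less_induct)
  case (less k)
  then obtain P :: "nat \<Rightarrow> real poly"
    where P: "\<And>i n. i < k \<Longrightarrow> (\<Sum>s<n. real s ^ i) = poly (P i) (real n)"
    by metis
  have "(\<Sum>s<n. real s ^ k)
      = poly (smult (1 / (k + 1)) (monom 1 (k + 1) - (\<Sum>i<k. smult (of_nat (Suc k choose i)) (P i)))) (real n)" for n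
  proof -
    have "real n ^ Suc k = (\<Sum>s<n. real (Suc s) ^ Suc k - real s ^ Suc k)"
      using sum_lessThan_telescope[of "\<lambda>s. real s ^ Suc k" n] by simp
    also have "\<dots> = (\<Sum>s<n. \<Sum>i\<le>k. of_nat (Suc k choose i) * real s ^ i)"
    proof (rule sum.cong)
      fix s
      have "real (Suc s) ^ Suc k = (real s + 1) ^ Suc k" by (simp add: add.commute)
      also have "\<dots> = (\<Sum>i\<le>Suc k. of_nat (Suc k choose i) * real s ^ i)"
        by (subst binomial_ring) simp
      finally show "real (Suc s) ^ Suc k - real s ^ Suc k
          = (\<Sum>i\<le>k. of_nat (Suc k choose i) * real s ^ i)" by simp
    qed simp
    also have "\<dots> = (\<Sum>i\<le>k. of_nat (Suc k choose i) * (\<Sum>s<n. real s ^ i))"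
      by (subst sum.swap) (simp add: sum_distrib_left)
    also have "\<dots> = (\<Sum>i<k. of_nat (Suc k choose i) * poly (P i) (real n)) + (k + 1) * (\<Sum>s<n. real s ^ k)"
      using P by (simp add: lessThan_Suc_atMost[symmetric] binomial_eq_0)
    finally show ?thesis by (simp add: poly_monom poly_sum field_simps)
  qed
  then show ?case by blast
qed

lemma sum_poly: "\<exists>P :: real poly. \<forall>n. (\<Sum>s<n. poly p (real s)) = poly P (real n)"
proof -
  obtain P :: "nat \<Rightarrow> real poly" where P: "\<And>k n. (\<Sum>s<n. real s ^ k) = poly (P k) (real n)"
    using power_sum_poly by metis
  have "(\<Sum>s<n. poly p (real s)) = poly (\<Sum>k\<le>degree p. smult (coeff p k) (P k)) (real n)" for n
    unfolding poly_altdef[of p]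
    by (subst sum.swap) (simp add: P sum_distrib_left[symmetric] poly_sum)
  then show ?thesis by blast
qed

text \<open>Below \<open>N\<close> the function may deviate from its polynomial, but from
  \<open>N\<close> on this changes the partial sums only by a constant. The composition with
  \<open>[:1, 1:]\<close> accounts for the inclusive upper limit.\<close>

lemma eventually_poly_partial_sums:
  assumes "eventually_poly f"
  shows "eventually_poly (\<lambda>n. \<Sum>s\<le>n. f s)"
proof -
  obtain p N where p: "\<And>n. n \<ge> N \<Longrightarrow> real (f n) = poly p (real n)"
    using assms by (rule eventually_polyE) blast
  obtain P :: "real poly" where P: "\<And>n. (\<Sum>s<n. poly p (real s)) = poly P (real n)"
    using sum_poly by metis
  have "real (\<Sum>s\<le>n. f s)
      = poly ([:(\<Sum>s<N. real (f s) - poly p (real s)):] + pcompose P [:1, 1:]) (real n)" if "N \<le> n" for n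
  proof -
    have "real (\<Sum>s\<le>n. f s) - (\<Sum>s<Suc n. poly p (real s)) = (\<Sum>s<Suc n. real (f s) - poly p (real s))"
      by (simp add: sum_subtractf lessThan_Suc_atMost)
    also have "\<dots> = (\<Sum>s<N. real (f s) - poly p (real s))"
      using p that by (intro sum.mono_neutral_right) auto
    finally show ?thesis using P[of "Suc n"] by (simp add: poly_pcompose add.commute)
  qed
  then show ?thesis by (rule eventually_polyI)
qed

section \<open>Counting multisets over a finite alphabet\<close>

lemma finite_multisets_size: "finite {M. set_mset M \<subseteq> {..<m::nat} \<and> size M = n}"
proof -
  have "{M. set_mset M \<subseteq> {..<m} \<and> size M = n} \<subseteq> mset ` {xs. set xs \<subseteq> {..<m} \<and> length xs = n}"
    by (auto simp: image_iff) (metis ex_mset set_mset_mset size_mset)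
  then show ?thesis by (rule finite_subset) (simp add: finite_lists_length_eq)
qed

text \<open>Induction on the alphabet, slicing \<open>X\<close> by the multiplicity \<open>t\<close>
  of the last letter \<open>m\<close>. The slices with \<open>t < T\<close> contribute finitely many
  shifted eventually polynomial functions. All slices with \<open>t \<ge> T\<close> coincide, so
  together they contribute partial sums of a single one.\<close>

lemma eventually_poly_card_multisets:
  fixes X :: "nat multiset set"
  assumes "\<And>M j. set_mset M \<subseteq> {..<m} \<Longrightarrow> j < m \<Longrightarrow> T \<le> count M j \<Longrightarrow> add_mset j M \<in> X \<longleftrightarrow> M \<in> X"
  shows "eventually_poly (\<lambda>n. card {M \<in> X. set_mset M \<subseteq> {..<m} \<and> size M = n})"
  using assms
proof (induction m arbitrary: X)
  case 0
  \<comment> \<open>Over the empty alphabet only the empty multiset remains, so the count vanishes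
    from \<open>n = 1\<close> on.\<close>
  show ?case by (rule eventually_polyI[of 1 _ 0]) auto
next
  case (Suc m)
  define N where "N X n = card {M \<in> X. set_mset M \<subseteq> {..<m} \<and> size M = n}"
    for X :: "nat multiset set" and n
  \<comment> \<open>The slice of multiplicity \<open>t\<close>, with the copies of \<open>m\<close>
    removed so that the induction hypothesis applies.\<close>
  define Y where "Y t = {M. M + replicate_mset t m \<in> X}" for t
  have EP: "eventually_poly (N (Y t))" for t
    unfolding N_def
  proof (rule Suc.IH)
    fix M j assume "set_mset M \<subseteq> {..<m}" "j < m" "T \<le> count M j"
    moreover from this have "set_mset (M + replicate_mset t m) \<subseteq> {..<Suc m}"
      by (auto simp: less_Suc_eq split: if_splits)
    ultimately show "add_mset j M \<in> Y t \<longleftrightarrow> M \<in> Y t"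
      using Suc.prems[of "M + replicate_mset t m" j] by (simp add: Y_def)
  qed
  have YT: "M \<in> Y t \<longleftrightarrow> M \<in> Y T" if "set_mset M \<subseteq> {..<m}" "T \<le> t" for M t
    using that(2)
  proof (induction t rule: dec_induct)
    case (step t)
    moreover have "set_mset (M + replicate_mset t m) \<subseteq> {..<Suc m}"
      using that(1) by (auto simp: less_Suc_eq split: if_splits)
    ultimately show ?case
      using Suc.prems[of "M + replicate_mset t m" m] by (simp add: Y_def)
  qed simp
  have NT: "N (Y t) n = N (Y T) n" if "T \<le> t" for t n
    unfolding N_def using YT[OF _ that] by (intro arg_cong[of _ _ card]) auto
  have split: "card {M \<in> X. set_mset M \<subseteq> {..<Suc m} \<and> size M = n} = (\<Sum>t\<le>n. N (Y t) (n - t))" for n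
  proof -
    let ?S = "\<lambda>t. {M \<in> Y t. set_mset M \<subseteq> {..<m} \<and> size M = n - t}"
    have "bij_betw (\<lambda>(t, M). M + replicate_mset t m) (Sigma {..n} ?S)
        {M \<in> X. set_mset M \<subseteq> {..<Suc m} \<and> size M = n}"
    proof (rule bij_betw_byWitness[where f' = "\<lambda>M. (count M m, filter_mset (\<lambda>i. i \<noteq> m) M)"])
      have *: "count (M + replicate_mset t m) m = t" "filter_mset (\<lambda>i. i \<noteq> m) (M + replicate_mset t m) = M"
        if "set_mset M \<subseteq> {..<m}" for M t
      proof -
        have "count M m = 0" using that by (auto simp: count_eq_zero_iff)
        then show "count (M + replicate_mset t m) m = t"
          "filter_mset (\<lambda>i. i \<noteq> m) (M + replicate_mset t m) = M"
          by (auto simp: multiset_eq_iff)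
      qed
      have dec: "filter_mset (\<lambda>i. i \<noteq> m) M + replicate_mset (count M m) m = M" for M :: "nat multiset"
        by (auto simp: multiset_eq_iff)
      show "\<forall>a\<in>Sigma {..n} ?S. (case (case a of (t, M) \<Rightarrow> M + replicate_mset t m) of
              M \<Rightarrow> (count M m, filter_mset (\<lambda>i. i \<noteq> m) M)) = a"
        using * by (auto simp del: count_union filter_union_mset)
      show "\<forall>M\<in>{M \<in> X. set_mset M \<subseteq> {..<Suc m} \<and> size M = n}.
          (case (count M m, filter_mset (\<lambda>i. i \<noteq> m) M) of (t, M) \<Rightarrow> M + replicate_mset t m) = M"
        using dec by simp
      show "(\<lambda>(t, M). M + replicate_mset t m) ` Sigma {..n} ?S \<subseteq> {M \<in> X. set_mset M \<subseteq> {..<Suc m} \<and> size M = n}"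
        by (auto simp: Y_def split: if_splits)
      show "(\<lambda>M. (count M m, filter_mset (\<lambda>i. i \<noteq> m) M)) ` {M \<in> X. set_mset M \<subseteq> {..<Suc m} \<and> size M = n}
          \<subseteq> Sigma {..n} ?S"
      proof clarify
        fix M assume M: "M \<in> X" "set_mset M \<subseteq> {..<Suc m}"
        have "size M = size (filter_mset (\<lambda>i. i \<noteq> m) M) + count M m"
          by (metis dec size_replicate_mset size_union)
        with M show "count M m \<in> {..size M} \<and> filter_mset (\<lambda>i. i \<noteq> m) M \<in>
            {Ma \<in> Y (count M m). set_mset Ma \<subseteq> {..<m} \<and> size Ma = size M - count M m}"
          by (auto simp: Y_def dec less_Suc_eq)
      qed
    qed
    then have "card {M \<in> X. set_mset M \<subseteq> {..<Suc m} \<and> size M = n} = card (Sigma {..n} ?S)"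
      by (simp add: bij_betw_same_card)
    also have "\<dots> = (\<Sum>t\<le>n. card (?S t))"
      by (intro card_SigmaI) (auto intro: finite_subset[OF _ finite_multisets_size[of m]])
    finally show ?thesis by (simp add: N_def)
  qed
  have "(\<Sum>t\<le>n. N (Y t) (n - t))
      = (\<Sum>t<T. if t \<le> n then N (Y t) (n - t) else 0) + (if T \<le> n then \<Sum>s\<le>n - T. N (Y T) s else 0)"
    if "T \<le> n" for n
  proof -
    have "{..n} = {..<T} \<union> {T..n}" using that by auto
    then have "(\<Sum>t\<le>n. N (Y t) (n - t)) = (\<Sum>t\<in>{..<T} \<union> {T..n}. N (Y t) (n - t))" by simp
    also have "\<dots> = (\<Sum>t<T. N (Y t) (n - t)) + (\<Sum>t\<in>{T..n}. N (Y t) (n - t))"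
      by (rule sum.union_disjoint) auto
    also have "(\<Sum>t\<in>{T..n}. N (Y t) (n - t)) = (\<Sum>t\<in>{T..n}. N (Y T) (n - t))"
      using NT by (intro sum.cong refl) (metis atLeastAtMost_iff)
    also have "\<dots> = (\<Sum>s\<le>n - T. N (Y T) s)"
      by (rule sum.reindex_bij_witness[of _ "\<lambda>s. n - s" "\<lambda>t. n - t"]) (use that in auto)
    finally show ?thesis using that by simp
  qed
  moreover have "eventually_poly (\<lambda>n. (\<Sum>t<T. if t \<le> n then N (Y t) (n - t) else 0)
      + (if T \<le> n then \<Sum>s\<le>n - T. N (Y T) s else 0))"
    by (intro eventually_poly_add eventually_poly_sum eventually_poly_shift
        eventually_poly_partial_sums EP) simp
  ultimately show ?case unfolding split by (rule eventually_poly_cong[rotated])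
qed

section \<open>Words with letter capacities\<close>

text \<open>The first difference between two words never falls on the second of two positions that
  repeat a letter in both words.\<close>

lemma lex_repeat:
  assumes "length us = length us'"
  shows "(us @ x # x # vs, us' @ x' # x' # vs') \<in> lex less_than \<longleftrightarrow>
    (us @ x # vs, us' @ x' # vs') \<in> lex less_than"
  using assms by (induction us us' rule: list_induct2) auto

lemma sorted_mset_unique: "sorted xs \<Longrightarrow> sorted ys \<Longrightarrow> mset xs = mset ys \<Longrightarrow> xs = ys"
  by (metis properties_for_sort sorted_sort_id)

text \<open>
  Letters in \<open>I\<close> may occur arbitrarily often, a letter \<open>j \<notin> I\<close> at most \<open>cap j\<close> times.
\<close>

locale word_coding =
  fixes m :: nat and col :: "nat \<Rightarrow> nat \<Rightarrow> 'c" and I :: "nat set" and cap :: "nat \<Rightarrow> nat"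
begin

definition words :: "nat list set" where
  "words = {y. sorted y \<and> set y \<subseteq> {..<m} \<and> (\<forall>j. j \<notin> I \<longrightarrow> count (mset y) j \<le> cap j)}"

definition same_col :: "nat \<times> nat \<Rightarrow> nat \<times> nat \<Rightarrow> bool" where
  "same_col = (\<lambda>(i, i') (j, j'). col i j = col i' j')"

text \<open>Equivalent words assign the same colours to corresponding pairs of positions. Stating
  this through \<open>sorted_wrt\<close> on the zipped words lets it split along appends, where
  words are pumped.\<close>

definition eqv :: "nat list \<Rightarrow> nat list \<Rightarrow> bool" where
  "eqv y y' \<longleftrightarrow> length y = length y' \<and> sorted_wrt same_col (zip y y')"

definition leader :: "nat list \<Rightarrow> bool" where
  "leader y \<longleftrightarrow> y \<in> words \<and> (\<forall>y'\<in>words. eqv y' y \<longrightarrow> (y', y) \<notin> lex less_than)"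

text \<open>A pigeonhole bound: among this many positions filled with letters below
  \<open>m\<close>, some letter \<open>i\<close> fills more than \<open>Suc (cap i)\<close>. More
  than \<open>cap i\<close> forces \<open>i\<close> into \<open>I\<close> for a word in
  \<open>words\<close>, and more than one position gives a repetition.\<close>

definition threshold :: nat where
  "threshold = Suc (\<Sum>i<m. Suc (cap i))"

lemma eqv_iff_nth:
  "eqv y y' \<longleftrightarrow> length y = length y' \<and>
    (\<forall>j<length y. \<forall>i<j. col (y ! i) (y ! j) = col (y' ! i) (y' ! j))"
  by (auto simp: eqv_def sorted_wrt_iff_nth_less same_col_def)

lemma eqv_sym: "eqv y y' \<Longrightarrow> eqv y' y"
  by (simp add: eqv_iff_nth)

lemma eqv_trans: "eqv y y' \<Longrightarrow> eqv y' y'' \<Longrightarrow> eqv y y''"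
  by (simp add: eqv_iff_nth)

text \<open>A third copy of a letter creates no new kind of pair, so the first part is an
  equivalence. A second copy creates the pair \<open>j\<close>, \<open>j\<close>, so the second part
  only goes from two copies to one.\<close>

lemma eqv_repeat:
  assumes "length us = length us'" "length vs = length vs'"
  shows "eqv (us @ j # j # j # vs) (us' @ j' # j' # j' # vs') \<longleftrightarrow> eqv (us @ j # j # vs) (us' @ j' # j' # vs')"
    and "eqv (us @ j # j # vs) (us' @ j' # j' # vs') \<Longrightarrow> eqv (us @ j # vs) (us' @ j' # vs')"
  using assms by (auto simp: eqv_def sorted_wrt_append)

lemma repeat_in_words:
  assumes "us @ j # j # vs \<in> words" "j \<in> I"
  shows "us @ j # j # j # vs \<in> words"
  using assms by (auto simp: words_def sorted_append split: if_splits)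

lemma drop_repeat_in_words:
  assumes "us @ j # j # vs \<in> words"
  shows "us @ j # vs \<in> words"
proof -
  have "count (mset (us @ j # vs)) i \<le> count (mset (us @ j # j # vs)) i" for i by simp
  moreover have "sorted (us @ j # vs)" "set (us @ j # vs) \<subseteq> {..<m}"
    using assms by (auto simp: words_def sorted_append)
  ultimately show ?thesis using assms unfolding words_def by (blast intro: le_trans)
qed

text \<open>
  Among many positions carrying the letter \<open>j\<close> in \<open>y\<close>, two adjacent ones also carry equal letters in
  \<open>y'\<close>, and that letter has unbounded capacity.  Both words can therefore be pumped, or shortened,
  at the same position, which affects neither their equivalence nor their lexicographic order.
\<close>

lemma adjacent_repeat:
  fixes y y' :: "nat list"
  assumes y: "sorted y" "threshold \<le> count (mset y) j" and y': "y' \<in> words" and len: "length y' = length y"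
  obtains us us' vs vs' j' where "y = us @ j # j # vs" "y' = us' @ j' # j' # vs'"
    "length us = length us'" "length vs = length vs'" "j' \<in> I"
proof -
  define K where "K = {k. k < length y \<and> y ! k = j}"
  have K: "finite K" "card K = count (mset y) j"
    by (auto simp: K_def count_mset count_list_eq_length_filter length_filter_conv_card eq_commute[of j])
  have bnd: "(!) y' ` K \<subseteq> {..<m}"
  proof
    fix i assume "i \<in> (!) y' ` K"
    then have "i \<in> set y'" using len by (auto simp: K_def)
    then show "i \<in> {..<m}" using y' by (auto simp: words_def)
  qed
  \<comment> \<open>Pigeonhole over the letters that \<open>y'\<close> carries at the positions in
    \<open>K\<close>.\<close>
  have "\<exists>i<m. Suc (cap i) < card {k \<in> K. y' ! k = i}"
  proof (rule ccontr)
    assume "\<not> ?thesis"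
    then have "(\<Sum>i<m. card {k \<in> K. y' ! k = i}) \<le> (\<Sum>i<m. Suc (cap i))"
      by (intro sum_mono) (metis lessThan_iff not_le)
    moreover have "(\<Sum>i<m. card {k \<in> K. y' ! k = i}) = card K"
      using sum.group[OF K(1) finite_lessThan bnd, of "\<lambda>_. 1 :: nat"] by (simp only: card_eq_sum)
    ultimately show False using y(2) K(2) unfolding threshold_def by linarith
  qed
  then obtain i where i: "i < m" "Suc (cap i) < card {k \<in> K. y' ! k = i}" by blast
  have "card {k \<in> K. y' ! k = i} \<le> card {k. k < length y' \<and> i = y' ! k}"
    by (rule card_mono) (auto simp: K_def len)
  also have "\<dots> = count (mset y') i" by (simp add: count_mset count_list_eq_length_filter length_filter_conv_card)
  finally have le: "card {k \<in> K. y' ! k = i} \<le> count (mset y') i" .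
  have iI: "i \<in> I"
  proof (rule ccontr)
    assume "i \<notin> I"
    then have "count (mset y') i \<le> cap i" using y' by (simp add: words_def)
    then show False using i le \<open>i \<notin> I\<close> by linarith
  qed
  have "1 < card {k \<in> K. y' ! k = i}" using i by linarith
  then have "\<not> card {k \<in> K. y' ! k = i} \<le> Suc 0" by simp
  then obtain k l where "k \<in> K" "l \<in> K" "y' ! k = i" "y' ! l = i" "k \<noteq> l"
    using card_le_Suc0_iff_eq[of "{k \<in> K. y' ! k = i}"] K(1) by auto
  then obtain k l where kl: "k \<in> K" "l \<in> K" "y' ! k = i" "y' ! l = i" "k < l"
    by (metis linorder_neqE_nat)
  then have l: "k < l" "l < length y" "y ! k = j" "y ! l = j" by (auto simp: K_def)
  have sk: "Suc k < length y" using l by linarith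
  \<comment> \<open>Sortedness squeezes the letter at \<open>Suc k\<close> between equal letters at
    \<open>k\<close> and \<open>l\<close>, in both words.\<close>
  have "y ! k \<le> y ! Suc k" "y ! Suc k \<le> y ! l" 
    using sorted_nth_mono[OF y(1), of k "Suc k"] sorted_nth_mono[OF y(1), of "Suc k" l] l by auto
  then have yk: "y ! Suc k = j" using l by simp
  have "sorted y'" using y' by (simp add: words_def)
  then have "y' ! k \<le> y' ! Suc k" "y' ! Suc k \<le> y' ! l"
    using sorted_nth_mono[of y' k "Suc k"] sorted_nth_mono[of y' "Suc k" l] l len by auto
  then have yk': "y' ! Suc k = i" using kl by simp
  have dec: "xs = take k xs @ xs ! k # xs ! Suc k # drop (Suc (Suc k)) xs" if "Suc k < length xs" for xs :: "nat list"
    using that by (simp add: Cons_nth_drop_Suc)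
  have "y = take k y @ j # j # drop (Suc (Suc k)) y"
    using dec[OF sk] unfolding l(3) yk .
  moreover have "y' = take k y' @ i # i # drop (Suc (Suc k)) y'"
    using dec[of y'] sk len unfolding kl(3) yk' by simp
  ultimately show thesis
    using that[of "take k y" "drop (Suc (Suc k)) y" "take k y'" i "drop (Suc (Suc k)) y'"] len iI
    by simp
qed

text \<open>A smaller equivalent rival of one word yields a rival of the other. A rival of
  \<open>y\<close> is pumped at the common repetition, which is possible because its letter there
  lies in \<open>I\<close>; a rival of \<open>insort j y\<close> is shortened there.\<close>

lemma leader_insort:
  assumes "sorted y" "set y \<subseteq> {..<m}" "threshold \<le> count (mset y) j"
  shows "leader (insort j y) \<longleftrightarrow> leader y"
proof
  assume lead: "leader (insort j y)"
  have yw: "y \<in> words"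
    unfolding words_def
  proof (intro CollectI conjI allI impI assms(1,2))
    fix i assume "i \<notin> I"
    then have "count (mset (insort j y)) i \<le> cap i" using lead by (simp add: leader_def words_def)
    then show "count (mset y) i \<le> cap i" by (simp split: if_splits)
  qed
  have "(y', y) \<notin> lex less_than" if y': "y' \<in> words" "eqv y' y" for y'
  proof
    assume lex: "(y', y) \<in> lex less_than"
    have "length y' = length y" using y' by (simp add: eqv_def)
    then obtain us us' vs vs' j' where d: "y = us @ j # j # vs" "y' = us' @ j' # j' # vs'"
      "length us = length us'" "length vs = length vs'" "j' \<in> I"
      using adjacent_repeat[OF assms(1,3) y'(1)] by metis
    have "insort j y = us @ j # j # j # vs"
      using assms(1) by (intro sorted_mset_unique) (auto simp: d sorted_insort sorted_append)
    moreover have "us' @ j' # j' # j' # vs' \<in> words" using repeat_in_words y'(1) d by blast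
    moreover have "eqv (us' @ j' # j' # j' # vs') (us @ j # j # j # vs)"
      using y'(2) eqv_repeat(1)[of us' us vs' vs] d by simp
    moreover have "(us' @ j' # j' # j' # vs', us @ j # j # j # vs) \<in> lex less_than"
      using lex d lex_repeat[of us' us j' "j' # vs'" j "j # vs"] by simp
    ultimately show False using lead by (metis leader_def)
  qed
  with yw show "leader y" by (simp add: leader_def)
next
  assume lead: "leader y"
  then have yw: "y \<in> words" by (simp add: leader_def)
  have cnt: "0 < count (mset y) j" "cap j < count (mset y) j"
  proof -
    show *: "0 < count (mset y) j" using assms(3) unfolding threshold_def by linarith
    then have "j < m" using assms(2) by auto
    then have "Suc (cap j) \<le> (\<Sum>i<m. Suc (cap i))"
      by (intro member_le_sum) auto
    then show "cap j < count (mset y) j" using assms(3) by (simp add: threshold_def)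
  qed
  then have "j < m" using assms(2) by auto
  \<comment> \<open>The letter \<open>j\<close> already exceeds its capacity in a word of
    \<open>words\<close>, so it must be unbounded.\<close>
  have jI: "j \<in> I" using yw cnt by (auto simp: words_def leD)
  have insw: "insort j y \<in> words"
    using yw jI \<open>j < m\<close> by (auto simp: words_def sorted_insort set_insort_key)
  have "(y', insort j y) \<notin> lex less_than" if y': "y' \<in> words" "eqv y' (insort j y)" for y'
  proof
    assume lex: "(y', insort j y) \<in> lex less_than"
    have "length y' = length (insort j y)" using y' by (simp add: eqv_def)
    moreover have "sorted (insort j y)" "threshold \<le> count (mset (insort j y)) j"
      using assms by (simp_all add: sorted_insort)
    ultimately obtain us us' vs vs' j' where d: "insort j y = us @ j # j # vs" "y' = us' @ j' # j' # vs'"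
      "length us = length us'" "length vs = length vs'" "j' \<in> I"
      using adjacent_repeat[OF _ _ y'(1)] by metis
    have "mset (insort j y) = mset (us @ j # j # vs)" by (simp add: d)
    moreover have "sorted (us @ j # j # vs)" using d(1) assms(1) by (metis sorted_insort)
    ultimately have "y = us @ j # vs"
      using assms(1) by (intro sorted_mset_unique) (auto simp: sorted_append)
    moreover have "us' @ j' # vs' \<in> words" using drop_repeat_in_words y'(1) d by blast
    moreover have "eqv (us' @ j' # vs') (us @ j # vs)"
      using y'(2) eqv_repeat(2)[of us' us vs' vs] d by simp
    moreover have "(us' @ j' # vs', us @ j # vs) \<in> lex less_than"
      using lex d lex_repeat[of us' us j' vs' j vs] by simp
    ultimately show False using lead by (metis leader_def)
  qed
  with insw show "leader (insort j y)" by (simp add: leader_def)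
qed

text \<open>Sorted words correspond to multisets, and \<open>leader_insort\<close> is the stability
  required by \<open>eventually_poly_card_multisets\<close>.\<close>

lemma eventually_poly_card_leaders: "eventually_poly (\<lambda>n. card {y. leader y \<and> length y = n})"
proof -
  define X where "X = {M. leader (sorted_list_of_multiset M)}"
  have "eventually_poly (\<lambda>n. card {M \<in> X. set_mset M \<subseteq> {..<m} \<and> size M = n})"
  proof (rule eventually_poly_card_multisets)
    fix M j assume "set_mset M \<subseteq> {..<m}" "threshold \<le> count M j"
    then show "add_mset j M \<in> X \<longleftrightarrow> M \<in> X"
      using leader_insort[of "sorted_list_of_multiset M" j] by (simp add: X_def)
  qed
  moreover have "card {y. leader y \<and> length y = n} = card {M \<in> X. set_mset M \<subseteq> {..<m} \<and> size M = n}" for n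
  proof (rule bij_betw_same_card[of mset], rule bij_betw_byWitness[where f' = sorted_list_of_multiset])
    have s: "sort y = y" "set y \<subseteq> {..<m}" if "leader y" for y
      using that by (auto simp: leader_def words_def sorted_sort_id)
    show "\<forall>y\<in>{y. leader y \<and> length y = n}. sorted_list_of_multiset (mset y) = y"
      using s by simp
    show "mset ` {y. leader y \<and> length y = n} \<subseteq> {M \<in> X. set_mset M \<subseteq> {..<m} \<and> size M = n}"
      using s(1) s(2)[THEN subsetD] by (auto simp: X_def)
    show "sorted_list_of_multiset ` {M \<in> X. set_mset M \<subseteq> {..<m} \<and> size M = n} \<subseteq> {y. leader y \<and> length y = n}"
      by (auto simp: X_def) (metis mset_sorted_list_of_multiset size_mset)
  qed simp
  ultimately show ?thesis by simp
qed

lemma ex_leader: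
  assumes "y \<in> words"
  shows "\<exists>y'. leader y' \<and> eqv y' y"
proof -
  have "wf (lex less_than)" by auto
  moreover have "y \<in> {y' \<in> words. eqv y' y}" using assms by (simp add: eqv_iff_nth)
  ultimately obtain y' where y': "y' \<in> {y' \<in> words. eqv y' y}"
    "\<And>y''. (y'', y') \<in> lex less_than \<Longrightarrow> y'' \<notin> {y' \<in> words. eqv y' y}"
    by (rule wfE_min) blast
  then have "leader y'" unfolding leader_def using eqv_trans by blast
  with y' show ?thesis by blast
qed

lemma leader_unique:
  assumes "leader y" "leader y'" "eqv y y'"
  shows "y = y'"
proof (rule ccontr)
  assume "y \<noteq> y'"
  moreover have "length y = length y'" using assms by (simp add: eqv_def)
  moreover have "total (lexord less_than)" by (intro total_lexord) simp
  ultimately have "(y, y') \<in> lex less_than \<or> (y', y) \<in> lex less_than"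
    by (auto simp: lexord_lex total_on_def)
  then show False using assms eqv_sym by (auto simp: leader_def)
qed

text \<open>Each class of \<open>eqv\<close> within \<open>words\<close> contains exactly one
  leader, so leaders enumerate the values of any function \<open>g\<close> whose fibres are the
  classes of \<open>eqv\<close> pulled back along \<open>f\<close>.\<close>

lemma card_codes_eq_card_leaders:
  assumes f: "f ` S = {y \<in> words. length y = n}"
    and g: "\<And>a b. a \<in> S \<Longrightarrow> b \<in> S \<Longrightarrow> g a = g b \<longleftrightarrow> eqv (f a) (f b)"
  shows "card (g ` S) = card {y. leader y \<and> length y = n}"
proof -
  let ?h = "inv_into S f"
  have h: "?h y \<in> S" "f (?h y) = y" if "leader y" "length y = n" for y
    using that f inv_into_into[of y f S] f_inv_into_f[of y f S] by (auto simp: leader_def)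
  have "bij_betw (g \<circ> ?h) {y. leader y \<and> length y = n} (g ` S)"
    unfolding bij_betw_def
  proof (intro conjI inj_onI subset_antisym subsetI)
    fix y y' assume "y \<in> {y. leader y \<and> length y = n}" "y' \<in> {y. leader y \<and> length y = n}"
      "(g \<circ> ?h) y = (g \<circ> ?h) y'"
    then show "y = y'" using h g[of "?h y" "?h y'"] leader_unique by auto
  next
    fix x assume "x \<in> g ` S"
    then obtain a where a: "a \<in> S" "x = g a" by blast
    then have fa: "f a \<in> words" "length (f a) = n" using f by auto
    then obtain y where y: "leader y" "eqv y (f a)" using ex_leader by blast
    then have ly: "length y = n" using fa by (simp add: eqv_def)
    then have "g (?h y) = x" using g[of "?h y" a] h[of y] y a by simp
    then show "x \<in> (g \<circ> ?h) ` {y. leader y \<and> length y = n}" using y ly by auto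
  qed (use h in auto)
  then show ?thesis by (simp add: bij_betw_same_card)
qed

end

section \<open>Linear orders with coloured pairs\<close>

text \<open>Ramsey's theorem for pairs: an unordered pair of naturals is coloured by
  \<open>G\<close> applied to its minimum and maximum, with the finitely many values numbered by
  \<open>e\<close>. The homogeneous set is then enumerated increasingly.\<close>

lemma infinite_pair_homogeneous:
  fixes G :: "nat \<Rightarrow> nat \<Rightarrow> 'd"
  assumes fin: "finite (case_prod G ` UNIV)"
  shows "\<exists>h :: nat \<Rightarrow> nat. \<exists>d. strict_mono h \<and> (\<forall>i j. i < j \<longrightarrow> G (h i) (h j) = d)"
proof -
  define S where "S = case_prod G ` UNIV"
  have "finite S" using fin by (simp add: S_def)
  then obtain e :: "'d \<Rightarrow> nat" and s where e: "inj_on e S" "e ` S = {i. i < s}"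
    using finite_imp_inj_to_nat_seg by metis
  have GS: "G i j \<in> S" for i j unfolding S_def by (metis UNIV_I case_prod_conv image_eqI)
  define f where "f X = e (G (Min X) (Max X))" for X :: "nat set"
  have lt: "f {x, y} < s" for x y
    using e(2) GS unfolding f_def by blast
  then obtain Y t where Y: "infinite Y" "\<forall>x\<in>Y. \<forall>y\<in>Y. x \<noteq> y \<longrightarrow> f {x, y} = t"
    using Ramsey2[of "UNIV :: nat set" f s] by auto
  define h where "h = enumerate Y"
  have mono: "strict_mono h" unfolding h_def using Y(1) by (rule strict_mono_enumerate)
  have hY: "h i \<in> Y" for i unfolding h_def using Y(1) by (simp add: enumerate_in_set)
  have ft: "e (G (h i) (h j)) = t" if "i < j" for i j
  proof -
    have "h i < h j" using mono that by (simp add: strict_mono_def)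
    moreover from this have "f {h i, h j} = e (G (h i) (h j))" by (simp add: f_def)
    ultimately show ?thesis using Y(2) hY by fastforce
  qed
  have "G (h i) (h j) = G (h 0) (h 1)" if "i < j" for i j
    using ft[OF that] ft[of 0 1] e(1) GS by (simp add: inj_on_def)
  with mono show ?thesis by blast
qed

text \<open>Abstracts an ordered binary structure to a strict order on \<open>E\<close> in which
  every ordered pair carries one of finitely many colours; all the relations are merged into
  \<open>c\<close>.\<close>

locale colored_order =
  fixes E :: "'a set" and lt :: "'a \<Rightarrow> 'a \<Rightarrow> bool" (infix "\<lhd>" 50)
    and c :: "'a \<Rightarrow> 'a \<Rightarrow> 'c"
  assumes irrefl: "\<not> x \<lhd> x"
    and trans: "x \<lhd> y \<Longrightarrow> y \<lhd> z \<Longrightarrow> x \<lhd> z"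
    and total: "x \<in> E \<Longrightarrow> y \<in> E \<Longrightarrow> x \<noteq> y \<Longrightarrow> x \<lhd> y \<or> y \<lhd> x"
    and color_swap: "c x y = c x' y' \<Longrightarrow> c y x = c y' x'"
    and color_diag: "c x y = c x' y' \<Longrightarrow> c x x = c x' x'"
    and finite_colors: "finite (range (case_prod c))"
begin

section \<open>Isomorphism of finite subsets and colour codes\<close>

definition iso :: "'a set \<Rightarrow> 'a set \<Rightarrow> bool" where
  "iso A B \<longleftrightarrow> (\<exists>f. bij_betw f A B \<and>
     (\<forall>x\<in>A. \<forall>y\<in>A. (x \<lhd> y \<longleftrightarrow> f x \<lhd> f y) \<and> c x y = c (f x) (f y)))"

lemma asym: "x \<lhd> y \<Longrightarrow> \<not> y \<lhd> x"
  using irrefl trans by blast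

lemma not_lt_iff: "x \<in> E \<Longrightarrow> y \<in> E \<Longrightarrow> \<not> x \<lhd> y \<longleftrightarrow> y = x \<or> y \<lhd> x"
  using total asym irrefl by blast

lemma ex_sorted_list:
  assumes "finite A" "A \<subseteq> E"
  shows "\<exists>xs. sorted_wrt (\<lhd>) xs \<and> set xs = A"
  using assms
proof (induction "card A" arbitrary: A)
  case 0
  then show ?case by auto
next
  case (Suc n)
  have "\<exists>m\<in>A. \<forall>x\<in>A. x = m \<or> m \<lhd> x" if "finite A" "A \<noteq> {}" "A \<subseteq> E" for A
    using that
  proof (induction A rule: finite_ne_induct)
    case (insert x F)
    then obtain m where m: "m \<in> F" "\<forall>y\<in>F. y = m \<or> m \<lhd> y" by auto
    have "x \<in> E" "m \<in> E" using insert.prems m by auto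
    then consider "x = m" | "x \<lhd> m" | "m \<lhd> x" using total by blast
    then show ?case
    proof cases
      case 2
      then have "x \<lhd> y" if "y \<in> F" for y using m(2) trans[OF 2] that by auto
      then have "\<forall>y\<in>insert x F. y = x \<or> x \<lhd> y" by simp
      then show ?thesis by blast
    qed (use m in auto)
  qed auto
  then obtain m where m: "m \<in> A" "\<forall>x\<in>A. x = m \<or> m \<lhd> x"
    using Suc.prems Suc.hyps(2) by (metis card.empty nat.distinct(1))
  have "n = card (A - {m})" using Suc m by simp
  then obtain xs where "sorted_wrt (\<lhd>) xs" "set xs = A - {m}"
    using Suc by (metis Diff_subset finite_Diff order_trans)
  with m have "sorted_wrt (\<lhd>) (m # xs) \<and> set (m # xs) = A" by auto
  then show ?case by blast
qed

lemma sorted_list_unique: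
  "sorted_wrt (\<lhd>) xs \<Longrightarrow> sorted_wrt (\<lhd>) ys \<Longrightarrow> set xs = set ys \<Longrightarrow> xs = ys"
proof (induction xs arbitrary: ys)
  case (Cons x xs)
  then obtain y ys' where ys: "ys = y # ys'" by (cases ys) auto
  have xy: "x = y"
    using Cons.prems ys asym by auto (metis insert_iff)
  have "set xs = set ys'"
    using Cons.prems ys xy irrefl by auto (metis insert_iff)+
  with Cons ys xy show ?case by simp
qed simp

lemma sorted_distinct: "sorted_wrt (\<lhd>) xs \<Longrightarrow> distinct xs"
  using irrefl by (induction xs) auto

definition sorted_elems :: "'a set \<Rightarrow> 'a list" where
  "sorted_elems A = (SOME xs. sorted_wrt (\<lhd>) xs \<and> set xs = A)"

lemma sorted_elems:
  assumes "finite A" "A \<subseteq> E"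
  shows "sorted_wrt (\<lhd>) (sorted_elems A)" "set (sorted_elems A) = A"
    "distinct (sorted_elems A)" "length (sorted_elems A) = card A"
proof -
  show *: "sorted_wrt (\<lhd>) (sorted_elems A)" "set (sorted_elems A) = A"
    using someI_ex[OF ex_sorted_list[OF assms]] unfolding sorted_elems_def by auto
  then show "distinct (sorted_elems A)" using sorted_distinct by blast
  with * show "length (sorted_elems A) = card A" by (metis distinct_card)
qed

lemma map_sorted_elems:
  assumes "finite A" "A \<subseteq> E" "B \<subseteq> E" "bij_betw f A B"
    and "\<And>x y. x \<in> A \<Longrightarrow> y \<in> A \<Longrightarrow> x \<lhd> y \<Longrightarrow> f x \<lhd> f y"
  shows "map f (sorted_elems A) = sorted_elems B"
proof (rule sorted_list_unique)
  have B: "finite B" using assms bij_betw_finite by blast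
  show "sorted_wrt (\<lhd>) (map f (sorted_elems A))"
    unfolding sorted_wrt_map
    by (rule sorted_wrt_mono_rel[OF _ sorted_elems(1)[OF assms(1,2)]])
      (use sorted_elems(2)[OF assms(1,2)] assms(5) in simp)
  show "sorted_wrt (\<lhd>) (sorted_elems B)" "set (map f (sorted_elems A)) = set (sorted_elems B)"
    using sorted_elems[OF assms(1,2)] sorted_elems[OF B assms(3)] assms(4)
    by (auto simp: bij_betw_def)
qed

text \<open>A canonical form: the colour matrix along the increasing enumeration. Counting
  isomorphism types becomes counting values of a function.\<close>

definition code :: "'a set \<Rightarrow> 'c list list" where
  "code A = map (\<lambda>x. map (c x) (sorted_elems A)) (sorted_elems A)"

lemma code_eq_iff:
  assumes "finite A" "A \<subseteq> E" "finite B" "B \<subseteq> E"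
  shows "code A = code B \<longleftrightarrow> card A = card B \<and>
    (\<forall>i<card A. \<forall>j<card A. c (sorted_elems A ! i) (sorted_elems A ! j)
                        = c (sorted_elems B ! i) (sorted_elems B ! j))"
  using sorted_elems(4)[OF assms(1,2)] sorted_elems(4)[OF assms(3,4)]
  by (auto simp: code_def list_eq_iff_nth_eq)

text \<open>An isomorphism preserves the order, so it can only send the \<open>i\<close>-th element
  to the \<open>i\<close>-th element.\<close>

lemma iso_iff_code:
  assumes A: "finite A" "A \<subseteq> E" and B: "finite B" "B \<subseteq> E"
  shows "iso A B \<longleftrightarrow> code A = code B"
proof
  assume "iso A B"
  then obtain f where f: "bij_betw f A B"
    "\<And>x y. x \<in> A \<Longrightarrow> y \<in> A \<Longrightarrow> (x \<lhd> y \<longleftrightarrow> f x \<lhd> f y) \<and> c x y = c (f x) (f y)"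
    unfolding iso_def by blast
  have "map f (sorted_elems A) = sorted_elems B"
    by (rule map_sorted_elems[OF A B(2) f(1)]) (simp add: f(2)[THEN conjunct1, symmetric])
  then have "sorted_elems B ! i = f (sorted_elems A ! i)" if "i < card A" for i
    using that sorted_elems(4)[OF A] by (metis nth_map)
  moreover have "sorted_elems A ! i \<in> A" if "i < card A" for i
    using that sorted_elems[OF A] by (metis nth_mem)
  ultimately show "code A = code B"
    unfolding code_eq_iff[OF A B] using bij_betw_same_card[OF f(1)] f(2) by simp
next
  assume "code A = code B"
  then have n: "card A = card B" and eq: "\<And>i j. i < card A \<Longrightarrow> j < card A \<Longrightarrow>
     c (sorted_elems A ! i) (sorted_elems A ! j) = c (sorted_elems B ! i) (sorted_elems B ! j)"
    unfolding code_eq_iff[OF A B] by auto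
  have bA: "bij_betw ((!) (sorted_elems A)) {..<card A} A"
    and bB: "bij_betw ((!) (sorted_elems B)) {..<card A} B"
    using bij_betw_nth sorted_elems[OF A] sorted_elems[OF B] n by metis+
  have ord: "xs ! i \<lhd> xs ! j \<longleftrightarrow> i < j"
    if "sorted_wrt (\<lhd>) xs" "i < length xs" "j < length xs" for xs i j
    using that sorted_wrt_nth_less[of "(\<lhd>)" xs] asym irrefl by (metis linorder_neqE_nat)
  define g where "g = the_inv_into {..<card A} ((!) (sorted_elems A))"
  have g: "bij_betw g A {..<card A}" unfolding g_def using bA by (rule bij_betw_the_inv_into)
  have gn: "sorted_elems A ! g x = x" "g x < card A" if "x \<in> A" for x
    using that bA g unfolding g_def
    by (metis bij_betw_def f_the_inv_into_f, metis bij_betwE lessThan_iff)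
  let ?f = "(!) (sorted_elems B) \<circ> g"
  have "bij_betw ?f A B" using g bB by (rule bij_betw_trans)
  moreover have "(x \<lhd> y \<longleftrightarrow> ?f x \<lhd> ?f y) \<and> c x y = c (?f x) (?f y)" if "x \<in> A" "y \<in> A" for x y
    using gn[OF that(1)] gn[OF that(2)] eq[of "g x" "g y"] n
      ord[OF sorted_elems(1)[OF A], of "g x" "g y"] ord[OF sorted_elems(1)[OF B], of "g x" "g y"]
      sorted_elems(4)[OF A] sorted_elems(4)[OF B] by auto
  ultimately show "iso A B" unfolding iso_def by blast
qed

lemma finite_codes: "finite (code ` {A. A \<subseteq> E \<and> finite A \<and> card A = n})"
proof (rule finite_subset)
  let ?C = "range (case_prod c)"
  have "c x y \<in> ?C" for x y by (metis UNIV_I case_prod_conv image_eqI)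
  then show "code ` {A. A \<subseteq> E \<and> finite A \<and> card A = n}
    \<subseteq> {xss. set xss \<subseteq> {xs. set xs \<subseteq> ?C \<and> length xs = n} \<and> length xss = n}"
    using sorted_elems(4) by (auto simp: code_def)
  show "finite {xss. set xss \<subseteq> {xs. set xs \<subseteq> ?C \<and> length xs = n} \<and> length xss = n}"
    by (intro finite_lists_length_eq finite_colors)
qed

lemma order_iso_unique:
  assumes A: "finite A" "A \<subseteq> E" and "B \<subseteq> E"
    and "bij_betw f A B" "\<And>x y. x \<in> A \<Longrightarrow> y \<in> A \<Longrightarrow> x \<lhd> y \<Longrightarrow> f x \<lhd> f y"
    and "bij_betw g A B" "\<And>x y. x \<in> A \<Longrightarrow> y \<in> A \<Longrightarrow> x \<lhd> y \<Longrightarrow> g x \<lhd> g y"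
    and "x \<in> A"
  shows "f x = g x"
proof -
  have "map f (sorted_elems A) = map g (sorted_elems A)"
    using map_sorted_elems assms by metis
  then show ?thesis using sorted_elems(2)[OF A] assms(8) by simp
qed

subsection \<open>Exponentially many types\<close>

text \<open>
  Slot \<open>j\<close> uses the three indices \<open>3 * j\<close>, \<open>3 * j + 1\<close>, \<open>3 * j + 2\<close>.  One of them, \<open>b j\<close>, contributes
  its witness \<open>z\<close> unconditionally.  In addition the slot contributes two points: either \<open>p\<close> and \<open>q\<close>
  at \<open>b j\<close>, which the witness tells apart, or two points \<open>p\<close> at the other two indices, which no witness
  of the family tells apart.  The choice does not affect the order pattern, so the
  \<open>2 ^ t\<close> choices in \<open>t\<close> slots are pairwise nonisomorphic.
\<close>

lemma uniform_exponential_family: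
  fixes p q z :: "nat \<Rightarrow> 'a"
  assumes inE: "\<And>i. p i \<in> E" "\<And>i. q i \<in> E" "\<And>i. z i \<in> E"
    and pq: "\<And>i. p i \<lhd> q i"
    and qp: "\<And>i j. i < j \<Longrightarrow> q i \<lhd> p j"
    and outside: "\<And>i. z i \<lhd> p i \<or> q i \<lhd> z i"
    and differ: "\<And>i. c (p i) (z i) \<noteq> c (q i) (z i)"
    and uniform: "\<And>i j. i < j \<Longrightarrow>
      (c (p j) (z i), c (p i) (z j), z i \<lhd> p j, z i \<lhd> q j, z j \<lhd> p i, z j \<lhd> q i, q i \<lhd> z j, z i \<lhd> p i)
      = (\<gamma>, \<gamma>', s1, s1', s2, s2', s3, D)"
  shows "\<exists>\<A> \<subseteq> {A. A \<subseteq> E \<and> finite A \<and> card A = n}.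
    card \<A> = 2 ^ (n div 3) \<and> (\<forall>A\<in>\<A>. \<forall>B\<in>\<A>. iso A B \<longrightarrow> A = B)"
proof -
  have col1: "c (p j) (z i) = \<gamma>" and col2: "c (p i) (z j) = \<gamma>'"
    and u1: "z i \<lhd> p j \<longleftrightarrow> s1" and u1': "z i \<lhd> q j \<longleftrightarrow> s1'"
    and u2: "z j \<lhd> p i \<longleftrightarrow> s2" and u2': "z j \<lhd> q i \<longleftrightarrow> s2'"
    and u3: "q i \<lhd> z j \<longleftrightarrow> s3" if "i < j" for i j
    using uniform[OF that] by auto
  have uD: "z i \<lhd> p i \<longleftrightarrow> D" for i using uniform[of i "Suc i"] by auto
  have pp: "p i \<lhd> p j" and qq: "q i \<lhd> q j" and pq': "p i \<lhd> q j" if "i < j" for i j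
    using trans qp[OF that] pq by blast+
  \<comment> \<open>If \<open>z 0\<close> lies below \<open>q 1\<close>, it lies below
    \<open>p 2\<close>, and uniformity carries this over to all later \<open>p\<close>.\<close>
  have s1: "s1' \<longleftrightarrow> s1"
    using u1[of 0 1] u1'[of 0 1] u1[of 0 2] trans[OF _ pq] trans[OF _ qp[of 1 2]] by auto
  \<comment> \<open>A witness never meets a later pair: lying on \<open>p j\<close> it would be
    below \<open>q j\<close> but not \<open>p j\<close>, and lying on \<open>q j\<close> it would be
    below \<open>p (Suc j)\<close> but not \<open>q j\<close>. So its side is the same for all later
    pairs.\<close>
  have sgn1: "(z i \<lhd> x \<longleftrightarrow> s1) \<and> (x \<lhd> z i \<longleftrightarrow> \<not> s1)" if ij: "i < j" and x: "x \<in> {p j, q j}" for i j x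
  proof -
    have "z i \<noteq> p j"
      using u1[OF ij] u1'[OF ij] s1 pq[of j] irrefl[of "p j"] by auto
    moreover have "z i \<noteq> q j"
      using u1[of i "Suc j"] u1'[OF ij] s1 qp[of j "Suc j"] irrefl[of "q j"] ij by auto
    ultimately show ?thesis
      using x u1[OF ij] u1'[OF ij] s1 not_lt_iff[of "z i" x] inE asym by auto
  qed
  have s2: "s2' \<longleftrightarrow> s2"
    using u2[of 0 2] u2'[of 0 2] u2[of 1 2] trans[OF _ pq] trans[OF _ qp[of 0 1]] by auto
  have sgn2: "(z i \<lhd> x \<longleftrightarrow> s2) \<and> (x \<lhd> z i \<longleftrightarrow> \<not> s2)" if ji: "j < i" and x: "x \<in> {p j, q j}" for i j x
  proof -
    have "z i \<noteq> p j"
      using u2[OF ji] u2'[OF ji] s2 pq[of j] irrefl[of "p j"] by auto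
    \<comment> \<open>For \<open>Suc j = i\<close> the next pair is not governed by
      \<open>s2\<close>. Hence \<open>s3\<close> transports the situation to the indices 0, 1, 2,
      where \<open>z 2\<close> would lie below \<open>p 1\<close> and force
      \<open>s2\<close>.\<close>
    moreover have "z i \<noteq> q j"
    proof
      assume zq: "z i = q j"
      then have "\<not> s3" using u3[OF ji] irrefl by auto
      then have "\<not> q 0 \<lhd> z 2" using u3[of 0 2] by auto
      then have "z 2 = q 0 \<or> z 2 \<lhd> q 0" using not_lt_iff inE by blast
      then have "z 2 \<lhd> p 1" using qp[of 0 1] trans by auto
      then have "s2" using u2[of 1 2] by auto
      then have "z i \<lhd> q j" using u2'[OF ji] s2 by auto
      then show False using zq irrefl by auto
    qed
    ultimately show ?thesis
      using x u2[OF ji] u2'[OF ji] s2 not_lt_iff[of "z i" x] inE asym by auto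
  qed

  \<comment> \<open>If witnesses lie below their own pairs (\<open>D\<close>), the lowest index of
    the slot is used, otherwise the highest. Either way the witness lies on one side of all points
    of its slot. The remaining two indices are \<open>l j\<close> and
    \<open>l j + 1\<close>.\<close>
  define b where "b j = (if D then 3 * j else 3 * j + 2)" for j :: nat
  define l where "l j = (if D then 3 * j + 1 else 3 * j)" for j :: nat
  \<comment> \<open>The set \<open>W\<close> collects the slots that use the separated pair;
    \<open>e W k\<close> is the \<open>k\<close>-th chosen point in increasing order, belonging to
    slot \<open>k div 2\<close>.\<close>
  define e where "e W k = (if k div 2 \<in> W then if even k then p (b (k div 2)) else q (b (k div 2))
      else p (l (k div 2) + k mod 2))" for W k
  define sg where "sg i j = (if i < j then s1 else if j < i then s2 else D)" for i j :: nat
  have b_bounds: "3 * j \<le> b j" "b j \<le> 3 * j + 2" for j unfolding b_def by auto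
  have e_index: "\<exists>\<beta>. 3 * (k div 2) \<le> \<beta> \<and> \<beta> \<le> 3 * (k div 2) + 2 \<and> e W k \<in> {p \<beta>, q \<beta>}" for W k
  proof (cases "k div 2 \<in> W")
    case True
    then show ?thesis using b_bounds[of "k div 2"]
      by (intro exI[of _ "b (k div 2)"]) (auto simp: e_def)
  next
    case False
    then show ?thesis
      by (intro exI[of _ "l (k div 2) + k mod 2"]) (auto simp: e_def l_def)
  qed
  have e_in: "e W k \<in> E" for W k using inE by (auto simp: e_def)
  have e_mono: "e W k \<lhd> e W k'" if kk: "k < k'" for W k k'
  proof (cases "k div 2 = k' div 2")
    case True
    then have k: "even k" "k mod 2 = 0" "k' = Suc k" using kk by presburger+
    then show ?thesis using pq pp by (auto simp: e_def)
  next
    case False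
    then have "k div 2 < k' div 2" using kk by (simp add: div_le_mono order.not_eq_order_implies_strict)
    moreover obtain \<beta> where "\<beta> \<le> 3 * (k div 2) + 2" "e W k \<in> {p \<beta>, q \<beta>}"
      using e_index by blast
    moreover obtain \<beta>' where "3 * (k' div 2) \<le> \<beta>'" "e W k' \<in> {p \<beta>', q \<beta>'}"
      using e_index by blast
    moreover from calculation have "\<beta> < \<beta>'" by linarith
    ultimately show ?thesis using pp qq qp pq' by auto
  qed
  have e_less: "e W k \<lhd> e W k' \<longleftrightarrow> k < k'" for W k k'
    using e_mono asym irrefl by (metis linorder_neqE_nat)
  have e_inj: "inj (e W)" for W
    using e_less irrefl by (metis injI linorder_neqE_nat)
  \<comment> \<open>The side on which a point lies of a witness depends only on the two slots and
    not on \<open>W\<close>, so all choices share one order pattern.\<close>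
  have z_e: "(z (b i) \<lhd> e W k \<longleftrightarrow> sg i (k div 2)) \<and> (e W k \<lhd> z (b i) \<longleftrightarrow> \<not> sg i (k div 2))" for W i k
  proof -
    obtain \<beta> where \<beta>: "3 * (k div 2) \<le> \<beta>" "\<beta> \<le> 3 * (k div 2) + 2" "e W k \<in> {p \<beta>, q \<beta>}"
      using e_index by blast
    consider "i < k div 2" | "k div 2 < i" | "k div 2 = i" by linarith
    then show ?thesis
    proof cases
      case 1
      then have "b i < \<beta>" using \<beta> b_bounds[of i] by linarith
      then show ?thesis using sgn1 \<beta> 1 by (simp add: sg_def)
    next
      case 2
      then have "\<beta> < b i" using \<beta> b_bounds[of i] by linarith
      then show ?thesis using sgn2 \<beta> 2 by (simp add: sg_def)
    next
      case 3
      show ?thesis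
      proof (cases D)
        case True
        then have zb: "z (b i) \<lhd> p (b i)" using uD by simp
        have "b i \<le> \<beta>" using True 3 \<beta> by (simp add: b_def)
        then have "z (b i) \<lhd> e W k"
          using \<beta>(3) zb trans[OF zb] pq pp pq' by (cases "\<beta> = b i") auto
        then show ?thesis using asym 3 True by (auto simp: sg_def)
      next
        case False
        then have zb: "q (b i) \<lhd> z (b i)" using uD outside by blast
        have "\<beta> \<le> b i" using False 3 \<beta> by (simp add: b_def)
        then have "e W k \<lhd> z (b i)"
          using \<beta>(3) zb trans[OF _ zb] pq pq' qq by (cases "\<beta> = b i") auto
        then show ?thesis using asym 3 False by (auto simp: sg_def)
      qed
    qed
  qed
  have z_neq_e: "z (b i) \<noteq> e W k" for i W k using z_e irrefl by metis

  define t where "t = n div 3"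
  define Z where "Z = (\<lambda>i. z (b i)) ` {..<t}"
  \<comment> \<open>Witnesses may coincide, so \<open>Z\<close> can have fewer than \<open>t\<close>
    elements; further points of the sequence \<open>e W\<close> fill the set up to exactly
    \<open>n\<close>.\<close>
  define N where "N = n - card Z"
  have "card Z \<le> t" using card_image_le[of "{..<t}" "\<lambda>i. z (b i)"] by (simp add: Z_def)
  then have N: "2 * t \<le> N" "card Z + N = n" unfolding N_def t_def by linarith+
  define A where "A W = Z \<union> e W ` {..<N}" for W
  have Ze: "Z \<inter> e W ` {..<N} = {}" for W using z_neq_e by (auto simp: Z_def)
  have A_card: "card (A W) = n" for W
    using Ze[of W] N e_inj[of W] card_image[of "e W" "{..<N}"]
    by (simp add: A_def card_Un_disjoint Z_def inj_on_subset)
  have A_in: "A W \<subseteq> E" "finite (A W)" for W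
    using e_in inE by (auto simp: A_def Z_def)
  have A_iso: "W \<subseteq> W'" if iso: "iso (A W) (A W')" and W: "W \<subseteq> {..<t}" for W W'
  proof
    fix j assume j: "j \<in> W"
    \<comment> \<open>The order isomorphism that fixes the witnesses and matches the chosen points
      by index. By uniqueness every isomorphism agrees with it.\<close>
    define g where "g x = (if x \<in> Z then x else e W' (inv (e W) x))" for x
    have gz: "g (z (b i)) = z (b i)" if "i < t" for i using that by (simp add: g_def Z_def)
    have ge: "g (e W k) = e W' k" for k
      using z_neq_e[symmetric] e_inj[of W] by (auto simp: g_def Z_def)
    have g_bij: "bij_betw g (A W) (A W')"
    proof -
      have "bij_betw g Z Z" by (intro bij_betwI[where g = g]) (auto simp: g_def)
      moreover have "bij_betw g (e W ` {..<N}) (e W' ` {..<N})"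
        unfolding bij_betw_def
      proof
        show "inj_on g (e W ` {..<N})"
          using e_inj[of W'] by (auto simp: inj_on_def ge dest: injD)
      qed (simp add: image_image ge)
      ultimately show ?thesis unfolding A_def using Ze by (intro bij_betw_combine) auto
    qed
    have g_mono: "g x \<lhd> g y" if "x \<in> A W" "y \<in> A W" "x \<lhd> y" for x y
      using that by (auto simp: A_def Z_def gz[unfolded Z_def] ge e_less z_e)
    obtain f where f: "bij_betw f (A W) (A W')"
      "\<And>x y. x \<in> A W \<Longrightarrow> y \<in> A W \<Longrightarrow> (x \<lhd> y \<longleftrightarrow> f x \<lhd> f y) \<and> c x y = c (f x) (f y)"
      using iso unfolding iso_def by blast
    have fg: "f x = g x" if "x \<in> A W" for x
      using f(2) by (intro order_iso_unique[OF A_in(2,1) A_in(1) f(1) _ g_bij g_mono that]) auto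
    have jt: "j < t" using j W by auto
    have "2 * j < N" "2 * j + 1 < N" using jt N by linarith+
    then have mem: "e W (2 * j) \<in> A W" "e W (2 * j + 1) \<in> A W" "z (b j) \<in> A W"
      using jt by (auto simp: A_def Z_def)
    have eq: "c (e W (2 * j)) (z (b j)) = c (e W' (2 * j)) (z (b j))"
      "c (e W (2 * j + 1)) (z (b j)) = c (e W' (2 * j + 1)) (z (b j))"
      using f(2)[OF mem(1,3)] f(2)[OF mem(2,3)] fg mem by (simp_all add: ge gz[OF jt])
    show "j \<in> W'"
    proof (rule ccontr)
      assume "j \<notin> W'"
      \<comment> \<open>Outside \<open>W'\<close> the slot consists of two \<open>p\<close> points
        on the same side of index \<open>b j\<close>, whose colours to the witness agree by
        uniformity; in \<open>W\<close> the corresponding colours differ.\<close>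
      then have "c (e W' (2 * j)) (z (b j)) = c (e W' (2 * j + 1)) (z (b j))"
        by (cases D) (auto simp: e_def b_def l_def col1 col2)
      then show False using eq j differ[of "b j"] by (simp add: e_def)
    qed
  qed
  define \<A> where "\<A> = A ` Pow {..<t}"
  have iso_refl: "iso B B" for B unfolding iso_def by (intro exI[of _ id]) auto
  have iso_sym: "iso B B'" if "iso B' B" "finite B" "B \<subseteq> E" "finite B'" "B' \<subseteq> E" for B B'
    using that iso_iff_code by metis
  have eq: "W = W'" if "iso (A W) (A W')" "W \<subseteq> {..<t}" "W' \<subseteq> {..<t}" for W W'
    using A_iso iso_sym A_in that by (metis subset_antisym)
  have "inj_on A (Pow {..<t})" using eq iso_refl by (metis PowD inj_onI)
  then have "card \<A> = 2 ^ t" unfolding \<A>_def by (simp add: card_image card_Pow)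
  moreover have "\<forall>B\<in>\<A>. \<forall>B'\<in>\<A>. iso B B' \<longrightarrow> B = B'" unfolding \<A>_def using eq by blast
  moreover have "\<A> \<subseteq> {A. A \<subseteq> E \<and> finite A \<and> card A = n}" unfolding \<A>_def using A_in A_card by blast
  ultimately show ?thesis unfolding t_def by blast
qed

lemma reversed: "colored_order E (\<lambda>x y. y \<lhd> x) c"
  using irrefl trans total color_swap color_diag finite_colors
  by unfold_locales blast+

lemma reversed_iso: "colored_order.iso (\<lambda>x y. y \<lhd> x) c = iso"
proof -
  interpret rev: colored_order E "\<lambda>x y. y \<lhd> x" c by (rule reversed)
  show ?thesis unfolding rev.iso_def[abs_def] iso_def[abs_def]
    by (intro ext iff_exI conj_cong refl) blast
qed

definition exponential_family :: "nat \<Rightarrow> bool" where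
  "exponential_family n \<longleftrightarrow> (\<exists>\<A> \<subseteq> {A. A \<subseteq> E \<and> finite A \<and> card A = n}.
    card \<A> = 2 ^ (n div 3) \<and> (\<forall>A\<in>\<A>. \<forall>B\<in>\<A>. iso A B \<longrightarrow> A = B))"

text \<open>The tuple \<open>G\<close> takes finitely many values, so Ramsey's theorem gives a
  subsequence on which the configuration is uniform.\<close>

lemma exponential_family_increasing:
  fixes p q z :: "nat \<Rightarrow> 'a"
  assumes inE: "\<And>i. p i \<in> E" "\<And>i. q i \<in> E" "\<And>i. z i \<in> E"
    and pq: "\<And>i. p i \<lhd> q i"
    and qp: "\<And>i j. i < j \<Longrightarrow> q i \<lhd> p j"
    and outside: "\<And>i. z i \<lhd> p i \<or> q i \<lhd> z i"
    and differ: "\<And>i. c (p i) (z i) \<noteq> c (q i) (z i)"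
  shows "exponential_family n"
proof -
  define G where "G i j = (c (p j) (z i), c (p i) (z j), z i \<lhd> p j, z i \<lhd> q j, z j \<lhd> p i, z j \<lhd> q i,
    q i \<lhd> z j, z i \<lhd> p i)" for i j
  let ?C = "range (case_prod c)"
  have C: "c x y \<in> ?C" for x y by (metis UNIV_I case_prod_conv image_eqI)
  have fin: "finite (case_prod G ` UNIV)"
    by (rule finite_subset[of _ "?C \<times> ?C \<times> UNIV"])
      (use C finite_colors in \<open>auto simp: G_def\<close>)
  obtain h :: "nat \<Rightarrow> nat" and d where hd: "strict_mono h \<and> (\<forall>i j. i < j \<longrightarrow> G (h i) (h j) = d)"
    using infinite_pair_homogeneous[OF fin] by auto
  then have h: "strict_mono h" and d: "\<And>i j. i < j \<Longrightarrow> G (h i) (h j) = d" by auto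
  have "d = G (h 0) (h 1)" using d[of 0 1] by simp
  then obtain \<gamma> \<gamma>' s1 s1' s2 s2' s3 D where d_eq: "d = (\<gamma>, \<gamma>', s1, s1', s2, s2', s3, D)"
    unfolding G_def by (rule that)
  show ?thesis
    unfolding exponential_family_def
  proof (rule uniform_exponential_family[of "\<lambda>i. p (h i)" "\<lambda>i. q (h i)" "\<lambda>i. z (h i)"])
    show "q (h i) \<lhd> p (h j)" if "i < j" for i j
      using h that qp by (simp add: strict_mono_def)
    show "(c (p (h j)) (z (h i)), c (p (h i)) (z (h j)), z (h i) \<lhd> p (h j), z (h i) \<lhd> q (h j),
        z (h j) \<lhd> p (h i), z (h j) \<lhd> q (h i), q (h i) \<lhd> z (h j), z (h i) \<lhd> p (h i))
      = (\<gamma>, \<gamma>', s1, s1', s2, s2', s3, D)" if "i < j" for i j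
      using d[OF that] unfolding G_def d_eq .
  qed (use assms in auto)
qed

text \<open>Reversing the order turns this into the increasing case with \<open>p\<close> and
  \<open>q\<close> exchanged; isomorphism is the same for both orders.\<close>

lemma exponential_family_decreasing:
  fixes p q z :: "nat \<Rightarrow> 'a"
  assumes "\<And>i. p i \<in> E" "\<And>i. q i \<in> E" "\<And>i. z i \<in> E"
    and "\<And>i. p i \<lhd> q i"
    and "\<And>i j. i < j \<Longrightarrow> q j \<lhd> p i"
    and "\<And>i. z i \<lhd> p i \<or> q i \<lhd> z i"
    and "\<And>i. c (p i) (z i) \<noteq> c (q i) (z i)"
  shows "exponential_family n"
proof -
  interpret rev: colored_order E "\<lambda>x y. y \<lhd> x" c by (rule reversed)
  have "rev.exponential_family n"
    using assms by (intro rev.exponential_family_increasing[of q p z]) metis+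
  then show ?thesis
    by (simp add: rev.exponential_family_def exponential_family_def reversed_iso)
qed

section \<open>Separated pairs and twin classes\<close>

definition separated :: "'a \<Rightarrow> 'a \<Rightarrow> bool" where
  "separated p q \<longleftrightarrow> p \<in> E \<and> q \<in> E \<and> p \<lhd> q \<and> (\<exists>z\<in>E. (z \<lhd> p \<or> q \<lhd> z) \<and> c p z \<noteq> c q z)"

abbreviation le (infix "\<unlhd>" 50) where
  "x \<unlhd> y \<equiv> x = y \<or> x \<lhd> y"

definition twins :: "'a rel" where
  "twins = {(x, y). x \<in> E \<and> y \<in> E \<and>
    (\<forall>p q. separated p q \<longrightarrow> \<not> (x \<unlhd> p \<and> q \<unlhd> y) \<and> \<not> (y \<unlhd> p \<and> q \<unlhd> x))}"

lemma le_trans': "x \<unlhd> y \<Longrightarrow> y \<unlhd> z \<Longrightarrow> x \<unlhd> z"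
  using trans by blast

text \<open>A witness for \<open>p\<close> and \<open>q\<close> lies outside both subintervals, and
  the colour at \<open>y\<close> cannot agree with both of the differing colours at \<open>p\<close>
  and \<open>q\<close>.\<close>

lemma separated_between:
  assumes "separated p q" "y \<in> E" "p \<lhd> y" "y \<lhd> q"
  shows "separated p y \<or> separated y q"
proof -
  obtain z where z: "z \<in> E" "z \<lhd> p \<or> q \<lhd> z" "c p z \<noteq> c q z"
    using assms by (auto simp: separated_def)
  then have "z \<lhd> p \<or> y \<lhd> z" "z \<lhd> y \<or> q \<lhd> z" using assms trans by blast+
  then show ?thesis using z assms unfolding separated_def by metis
qed

lemma twinsD: "(x, y) \<in> twins \<Longrightarrow> separated p q \<Longrightarrow> x \<unlhd> p \<Longrightarrow> q \<unlhd> y \<Longrightarrow> False"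
  unfolding twins_def by blast

lemma twins_in: "(x, y) \<in> twins \<Longrightarrow> x \<in> E \<and> y \<in> E"
  by (auto simp: twins_def)

lemma twins_sym: "(x, y) \<in> twins \<Longrightarrow> (y, x) \<in> twins"
  by (auto simp: twins_def)

lemma twins_refl: "x \<in> E \<Longrightarrow> (x, x) \<in> twins"
  unfolding twins_def separated_def using trans irrefl by blast

text \<open>A separated pair inside neither of the two intervals must straddle \<open>y\<close>, and
  then \<open>separated_between\<close> places one inside one of them. The auxiliary fact is stated
  for arbitrary \<open>u\<close> and \<open>v\<close> to serve both orientations.\<close>

lemma twins_trans:
  assumes "(x, y) \<in> twins" "(y, z) \<in> twins"
  shows "(x, z) \<in> twins"
proof -
  have no: False if s: "separated p q" and uv: "(u, y) \<in> twins" "(y, v) \<in> twins"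
    and pq: "u \<unlhd> p" "q \<unlhd> v" for p q u v
  proof -
    have E: "p \<in> E" "q \<in> E" "y \<in> E" using s uv by (auto simp: separated_def twins_def)
    have "\<not> y \<unlhd> p" "\<not> q \<unlhd> y" using twinsD uv s pq by blast+
    then have "p \<lhd> y" "y \<lhd> q" using total[of p y] total[of y q] E by auto
    then have "separated p y \<or> separated y q" using separated_between s E by blast
    then show False using twinsD[OF uv(1), of p y] twinsD[OF uv(2), of y q] pq by blast
  qed
  show ?thesis
    unfolding twins_def
  proof (intro CollectI case_prodI conjI allI impI notI)
    show "x \<in> E" "z \<in> E" using assms twins_in by blast+
    fix p q assume s: "separated p q"
    show False if "x \<unlhd> p \<and> q \<unlhd> z" using no[OF s assms] that by blast
    show False if "z \<unlhd> p \<and> q \<unlhd> x"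
      using no[OF s twins_sym[OF assms(2)] twins_sym[OF assms(1)]] that by blast
  qed
qed

lemma twins_equiv: "equiv E twins"
  by (intro equivI subsetI refl_onI symI transI)
    (auto intro: twins_refl twins_sym twins_trans simp: twins_in dest: twins_in)

lemma not_twins_separated:
  assumes "x \<in> E" "y \<in> E" "x \<lhd> y" "(x, y) \<notin> twins"
  shows "\<exists>p q. separated p q \<and> x \<unlhd> p \<and> q \<unlhd> y"
proof -
  have "\<not> (y \<unlhd> p \<and> q \<unlhd> x)" if "separated p q" for p q
  proof -
    have "p \<lhd> q" using that by (simp add: separated_def)
    then show ?thesis using assms(3) le_trans'[of y p q] le_trans'[of y q x] asym irrefl by blast
  qed
  then show ?thesis using assms unfolding twins_def by blast
qed

text \<open>Representatives of distinct classes contain a monotone sequence by Ramsey's theorem. The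
  intervals between its members \<open>2 * i\<close> and \<open>2 * i + 1\<close> are disjoint, and
  each contains a separated pair.\<close>

lemma infinite_twins_exponential:
  assumes inf: "infinite (E // twins)"
  shows "exponential_family n"
proof -
  obtain F :: "nat \<Rightarrow> 'a set" where F: "inj F" "range F \<subseteq> E // twins"
    using infinite_countable_subset[OF inf] by blast
  have "\<exists>x. x \<in> F i" for i
    using F(2) in_quotient_imp_non_empty[OF twins_equiv] by blast
  then obtain x where x: "\<And>i. x i \<in> F i" by metis
  have xE: "x i \<in> E" for i
    using x F(2) in_quotient_imp_subset[OF twins_equiv] by blast
  have xx: "(x i, x j) \<notin> twins" if "i \<noteq> j" for i j
  proof
    assume "(x i, x j) \<in> twins"
    then have "F i = F j" using quotient_eq_iff[OF twins_equiv _ _ x x] F(2) by blast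
    then show False using F(1) that by (auto simp: inj_def)
  qed
  have fin: "finite (case_prod (\<lambda>i j. x i \<lhd> x j) ` UNIV)" by simp
  obtain h :: "nat \<Rightarrow> nat" and d where hd: "strict_mono h \<and> (\<forall>i j. i < j \<longrightarrow> (x (h i) \<lhd> x (h j)) = d)"
    using infinite_pair_homogeneous[OF fin] by auto
  then have h: "strict_mono h" and d: "\<And>i j. i < j \<Longrightarrow> (x (h i) \<lhd> x (h j)) = d" by blast+
  define y where "y i = x (h i)" for i
  have yE: "y i \<in> E" for i by (simp add: y_def xE)
  have yy: "(y i, y j) \<notin> twins" if "i \<noteq> j" for i j
    using that xx strict_mono_eq[OF h] by (simp add: y_def)
  show ?thesis
  proof (cases d)
    case True
    then have mono: "y i \<lhd> y j" if "i < j" for i j using d[OF that] by (simp add: y_def)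
    have "\<exists>p q. separated p q \<and> y (2 * i) \<unlhd> p \<and> q \<unlhd> y (2 * i + 1)" for i
      by (rule not_twins_separated) (use yE mono yy in auto)
    then obtain p q where pq: "\<And>i. separated (p i) (q i)"
      "\<And>i. y (2 * i) \<unlhd> p i" "\<And>i. q i \<unlhd> y (2 * i + 1)" by metis
    then obtain z where z: "\<And>i. z i \<in> E" "\<And>i. z i \<lhd> p i \<or> q i \<lhd> z i"
      "\<And>i. c (p i) (z i) \<noteq> c (q i) (z i)" unfolding separated_def by metis
    show ?thesis
    proof (rule exponential_family_increasing[of p q z])
      show "q i \<lhd> p j" if "i < j" for i j
      proof -
        have m: "y (2 * i + 1) \<lhd> y (2 * j)" using mono that by simp
        have "q i \<lhd> y (2 * j)" using pq(3)[of i] m trans by metis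
        then show ?thesis using pq(2)[of j] trans by metis
      qed
    qed (use pq(1) z in \<open>auto simp: separated_def\<close>)
  next
    case False
    have mono: "y j \<lhd> y i" if "i < j" for i j
    proof -
      have "\<not> y i \<lhd> y j" using d[OF that] False by (simp add: y_def)
      moreover have "y i \<noteq> y j" using yy[of i j] twins_refl[OF yE[of i]] that by force
      ultimately show ?thesis using total yE by blast
    qed
    have "\<exists>p q. separated p q \<and> y (2 * i + 1) \<unlhd> p \<and> q \<unlhd> y (2 * i)" for i
      by (rule not_twins_separated) (use yE mono yy in auto)
    then obtain p q where pq: "\<And>i. separated (p i) (q i)"
      "\<And>i. y (2 * i + 1) \<unlhd> p i" "\<And>i. q i \<unlhd> y (2 * i)" by metis
    then obtain z where z: "\<And>i. z i \<in> E" "\<And>i. z i \<lhd> p i \<or> q i \<lhd> z i"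
      "\<And>i. c (p i) (z i) \<noteq> c (q i) (z i)" unfolding separated_def by metis
    show ?thesis
    proof (rule exponential_family_decreasing[of p q z])
      show "q j \<lhd> p i" if "i < j" for i j
      proof -
        have m: "y (2 * j) \<lhd> y (2 * i + 1)" using mono that by simp
        have "q j \<lhd> y (2 * i + 1)" using pq(3)[of j] m trans by metis
        then show ?thesis using pq(2)[of i] trans by metis
      qed
    qed (use pq(1) z in \<open>auto simp: separated_def\<close>)
  qed
qed

subsection \<open>Finitely many twin classes\<close>

lemma twins_color:
  assumes "(p, q) \<in> twins" "p \<unlhd> q" "z \<in> E" "z \<lhd> p \<or> q \<lhd> z"
  shows "c p z = c q z"
proof (cases "p = q")
  case False
  then have "\<not> separated p q" using assms unfolding twins_def by blast
  then show ?thesis using assms False by (auto simp: separated_def twins_def)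
qed simp

text \<open>Both pairs are compared with the widest one: first the left point is moved down to
  \<open>l\<close>, then the right point up to \<open>h\<close>. Each move keeps the other point
  outside the interval traversed.\<close>

lemma twins_color_eq:
  assumes "(x, x') \<in> twins" "(y, y') \<in> twins" "x \<lhd> y" "x' \<lhd> y'"
  shows "c x y = c x' y'"
proof -
  have E: "x \<in> E" "x' \<in> E" "y \<in> E" "y' \<in> E" using assms twins_in by blast+
  have *: "c u v = c l h" if "(l, u) \<in> twins" "(v, h) \<in> twins" "l \<unlhd> u" "v \<unlhd> h" "u \<lhd> v" for u v l h
  proof -
    have "l \<lhd> v" using that trans by blast
    have "c l v = c u v" using twins_color[OF that(1,3)] that twins_in by blast
    moreover have "c v l = c h l" using twins_color[OF that(2,4)] \<open>l \<lhd> v\<close> that twins_in by blast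
    ultimately show ?thesis using color_swap[of v l h l] by simp
  qed
  define l where "l = (if x \<lhd> x' then x else x')"
  define h where "h = (if y \<lhd> y' then y' else y)"
  have l: "l \<unlhd> x" "l \<unlhd> x'" "(l, x) \<in> twins" "(l, x') \<in> twins"
    using E total[of x x'] assms(1) twins_sym twins_refl by (auto simp: l_def)
  have h: "y \<unlhd> h" "y' \<unlhd> h" "(y, h) \<in> twins" "(y', h) \<in> twins"
    using E total[of y y'] assms(2) twins_sym twins_refl by (auto simp: h_def)
  show ?thesis using *[OF l(3) h(3) l(1) h(1) assms(3)] *[OF l(4) h(4) l(2) h(2) assms(4)] by simp
qed

lemma twins_between:
  assumes "(x, y) \<in> twins" "u \<in> E" "x \<unlhd> u" "u \<unlhd> y"
  shows "(x, u) \<in> twins"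
proof -
  have "\<not> (x \<unlhd> p \<and> q \<unlhd> u) \<and> \<not> (u \<unlhd> p \<and> q \<unlhd> x)" if s: "separated p q" for p q
  proof
    show "\<not> (x \<unlhd> p \<and> q \<unlhd> u)"
      using twinsD[OF assms(1) s] assms(4) le_trans'[of q u y] by blast
    have "p \<lhd> q" using s by (simp add: separated_def)
    then show "\<not> (u \<unlhd> p \<and> q \<unlhd> x)"
      using assms(3) le_trans'[of u p] le_trans'[of u q x] asym irrefl by blast
  qed
  then show ?thesis using assms twins_in unfolding twins_def by blast
qed

text \<open>Diagonal colours are read off from colours to a third point \<open>w\<close>, which
  exists because \<open>E\<close> is infinite. If \<open>w\<close> lies between the two twins, it is
  a twin of both, and the comparison passes through its own diagonal colour.\<close>

lemma twins_diag:
  assumes inf: "infinite E" and xy: "(x, y) \<in> twins"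
  shows "c x x = c y y"
proof -
  have *: "c u u = c v v" if uv: "(u, v) \<in> twins" "u \<lhd> v" for u v
  proof -
    have "infinite (E - {u, v})" using inf by simp
    then obtain w where w: "w \<in> E" "w \<noteq> u" "w \<noteq> v"
      by (metis Diff_iff ex_in_conv finite.emptyI insert_iff)
    have E: "u \<in> E" "v \<in> E" using uv twins_in by blast+
    consider "w \<lhd> u \<or> v \<lhd> w" | "u \<lhd> w" "w \<lhd> v" using w E total by metis
    then show ?thesis
    proof cases
      case 1
      then show ?thesis using twins_color[OF uv(1) _ w(1)] uv(2) color_diag by blast
    next
      case 2
      have uw: "(u, w) \<in> twins" using twins_between[OF uv(1) w(1)] 2 by blast
      then have wv: "(w, v) \<in> twins" using uv(1) twins_sym twins_trans by blast
      have "c u v = c w v" using twins_color[OF uw _ E(2)] 2 by blast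
      moreover have "c w u = c v u" using twins_color[OF wv _ E(1)] 2 by blast
      ultimately show ?thesis using color_diag by metis
    qed
  qed
  show ?thesis
    using *[OF xy] *[OF twins_sym[OF xy]] total[of x y] twins_in[OF xy] by metis
qed

text \<open>Classes are numbered from left to right: the number of \<open>x\<close> counts the other
  classes that have an element below \<open>x\<close>. Convexity makes this constant on each class
  and strictly increasing between classes.\<close>

lemma finite_twins_blocks:
  assumes fin: "finite (E // twins)"
  obtains blk :: "'a \<Rightarrow> nat" and m where
    "\<And>x. x \<in> E \<Longrightarrow> blk x < m"
    "\<And>x y. x \<in> E \<Longrightarrow> y \<in> E \<Longrightarrow> blk x = blk y \<longleftrightarrow> (x, y) \<in> twins"
    "\<And>x y. x \<in> E \<Longrightarrow> y \<in> E \<Longrightarrow> x \<lhd> y \<Longrightarrow> blk x \<le> blk y"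
proof -
  define S where "S x = {C \<in> E // twins. C \<noteq> twins `` {x} \<and> (\<exists>u\<in>C. u \<lhd> x)}" for x
  have finS: "finite (S x)" for x using fin by (simp add: S_def)
  have cls: "C = twins `` {u}" if C: "C \<in> E // twins" "u \<in> C" for C u
  proof -
    obtain x where "C = twins `` {x}" using C(1) unfolding quotient_def by blast
    then show ?thesis using C(2) equiv_class_eq[OF twins_equiv, of x u] by simp
  qed
  have lt: "S x \<subset> S y" if E: "x \<in> E" "y \<in> E" and xy: "x \<lhd> y" "(x, y) \<notin> twins" for x y
  proof
    have ne: "twins `` {x} \<noteq> twins `` {y}"
      using eq_equiv_class_iff[OF twins_equiv E] xy by blast
    have "C \<in> S y" if C: "C \<in> S x" for C
    proof -
      obtain u where u: "u \<in> C" "u \<lhd> x" using C by (auto simp: S_def)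
      have "C \<noteq> twins `` {y}"
      proof
        assume "C = twins `` {y}"
        then have uy: "(u, y) \<in> twins" using u twins_sym by blast
        then have "(u, x) \<in> twins" using twins_between[OF uy E(1)] u xy by blast
        then show False using uy xy twins_sym twins_trans by blast
      qed
      then show ?thesis using C u trans xy by (auto simp: S_def)
    qed
    then show "S x \<subseteq> S y" by blast
    have "x \<in> twins `` {x}" using twins_refl[OF E(1)] by simp
    then have "twins `` {x} \<in> S y"
      using quotientI[OF E(1), of twins] xy(1) ne unfolding S_def by blast
    moreover have "twins `` {x} \<notin> S x" by (simp add: S_def)
    ultimately show "S x \<noteq> S y" by blast
  qed
  have eq: "S x \<subseteq> S y" if E: "x \<in> E" "y \<in> E" and xy: "(x, y) \<in> twins" for x y
  proof
    fix C assume C: "C \<in> S x"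
    have xy': "twins `` {x} = twins `` {y}" using equiv_class_eq[OF twins_equiv xy] .
    obtain u where u: "u \<in> C" "u \<lhd> x" using C by (auto simp: S_def)
    have uE: "u \<in> E" using u C in_quotient_imp_subset[OF twins_equiv] by (auto simp: S_def)
    have "u \<lhd> y"
    proof (rule ccontr)
      assume "\<not> u \<lhd> y"
      then have "y \<unlhd> u" using not_lt_iff uE E by metis
      then have "(y, u) \<in> twins" using twins_between[OF twins_sym[OF xy] uE] u by blast
      then have "C = twins `` {x}"
        using cls[of C u] C u xy' equiv_class_eq[OF twins_equiv] by (auto simp: S_def)
      then show False using C by (simp add: S_def)
    qed
    then show "C \<in> S y" using C u xy' by (auto simp: S_def)
  qed
  have less: "card (S x) < card (S y)" if "x \<in> E" "y \<in> E" "x \<lhd> y" "(x, y) \<notin> twins" for x y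
    using psubset_card_mono[OF finS lt[OF that]] .
  have same: "card (S x) = card (S y)" if "(x, y) \<in> twins" for x y
    using eq that twins_in twins_sym by (metis subset_antisym)
  show thesis
  proof (rule that[of "\<lambda>x. card (S x)" "card (E // twins) + 1"])
    show "card (S x) < card (E // twins) + 1" for x
      using card_mono[OF fin, of "S x"] by (auto simp: S_def)
    show "card (S x) = card (S y) \<longleftrightarrow> (x, y) \<in> twins" if "x \<in> E" "y \<in> E" for x y
      using less[OF that] less[OF that(2,1)] same[of x y] that total[of x y] twins_sym twins_refl
      by (metis less_irrefl)
    show "card (S x) \<le> card (S y)" if "x \<in> E" "y \<in> E" "x \<lhd> y" for x y
      using less[OF that] same[of x y] by (cases "(x, y) \<in> twins") auto
  qed
qed

lemma card_sorted_elems_fibre: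
  assumes "finite A" "A \<subseteq> E"
  shows "count (mset (map f (sorted_elems A))) j = card {x \<in> A. f x = j}"
proof -
  have "count (mset (map f (sorted_elems A))) j = length (filter (\<lambda>x. f x = j) (sorted_elems A))"
    by (simp add: count_mset count_list_eq_length_filter filter_map comp_def eq_commute[of j] del: mset_map)
  also have "\<dots> = card {x \<in> A. f x = j}"
    using sorted_elems[OF assms] by (simp add: distinct_length_filter Collect_conj_eq Int_commute)
  finally show ?thesis .
qed

lemma finite_twins_coloring:
  assumes fin: "finite (E // twins)"
  obtains blk :: "'a \<Rightarrow> nat" and m and col :: "nat \<Rightarrow> nat \<Rightarrow> 'c" where
    "\<And>x. x \<in> E \<Longrightarrow> blk x < m"
    "\<And>x y. x \<in> E \<Longrightarrow> y \<in> E \<Longrightarrow> blk x = blk y \<longleftrightarrow> (x, y) \<in> twins"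
    "\<And>A. finite A \<Longrightarrow> A \<subseteq> E \<Longrightarrow> sorted (map blk (sorted_elems A))"
    "\<And>x y. x \<in> E \<Longrightarrow> y \<in> E \<Longrightarrow> x \<lhd> y \<Longrightarrow> c x y = col (blk x) (blk y)"
proof -
  obtain blk :: "'a \<Rightarrow> nat" and m where blk: "\<And>x. x \<in> E \<Longrightarrow> blk x < m"
    "\<And>x y. x \<in> E \<Longrightarrow> y \<in> E \<Longrightarrow> blk x = blk y \<longleftrightarrow> (x, y) \<in> twins"
    "\<And>x y. x \<in> E \<Longrightarrow> y \<in> E \<Longrightarrow> x \<lhd> y \<Longrightarrow> blk x \<le> blk y"
    by (rule finite_twins_blocks[OF fin]) (rule that)
  \<comment> \<open>By \<open>twins_color_eq\<close> the choice of representatives is immaterial;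
    the value is arbitrary where no increasing pair exists.\<close>
  define col where "col i j = (SOME k. \<exists>x\<in>E. \<exists>y\<in>E. x \<lhd> y \<and> blk x = i \<and> blk y = j \<and> k = c x y)" for i j
  have col: "c x y = col (blk x) (blk y)" if "x \<in> E" "y \<in> E" "x \<lhd> y" for x y
  proof -
    have "\<exists>x'\<in>E. \<exists>y'\<in>E. x' \<lhd> y' \<and> blk x' = blk x \<and> blk y' = blk y \<and> col (blk x) (blk y) = c x' y'"
      unfolding col_def by (rule someI_ex) (use that in blast)
    then obtain x' y' where *: "x' \<in> E" "y' \<in> E" "x' \<lhd> y'" "blk x' = blk x" "blk y' = blk y"
      "col (blk x) (blk y) = c x' y'" by blast
    then have "(x, x') \<in> twins" "(y, y') \<in> twins" using blk(2) that by metis+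
    then show ?thesis using twins_color_eq[of x x' y y'] that * by simp
  qed
  have srt: "sorted (map blk (sorted_elems A))" if "finite A" "A \<subseteq> E" for A
    unfolding sorted_wrt_map
    by (rule sorted_wrt_mono_rel[OF _ sorted_elems(1)[OF that]])
      (use sorted_elems(2)[OF that] blk(3) that in auto)
  show thesis by (rule that[OF blk(1,2) srt col])
qed

text \<open>The block word of a set determines the colours of its increasing pairs, and the block
  words of \<open>n\<close>-element sets are exactly the words respecting the block sizes. So codes
  correspond to leaders.\<close>

lemma finite_twins_eventually_poly:
  assumes fin: "finite (E // twins)"
  shows "eventually_poly (\<lambda>n. card (code ` {A. A \<subseteq> E \<and> finite A \<and> card A = n}))"
proof -
  obtain blk :: "'a \<Rightarrow> nat" and m and col
    where blk: "\<And>x. x \<in> E \<Longrightarrow> blk x < m"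
    and twins: "\<And>x y. x \<in> E \<Longrightarrow> y \<in> E \<Longrightarrow> blk x = blk y \<longleftrightarrow> (x, y) \<in> twins"
    and srt: "\<And>A. finite A \<Longrightarrow> A \<subseteq> E \<Longrightarrow> sorted (map blk (sorted_elems A))"
    and col: "\<And>x y. x \<in> E \<Longrightarrow> y \<in> E \<Longrightarrow> x \<lhd> y \<Longrightarrow> c x y = col (blk x) (blk y)"
    by (rule finite_twins_coloring[OF fin]) (rule that)
  define B where "B j = {x \<in> E. blk x = j}" for j
  \<comment> \<open>For infinite blocks \<open>card (B j)\<close> is 0, which is harmless since
    letters in \<open>I\<close> have no capacity bound.\<close>
  interpret word_coding m col "{j. infinite (B j)}" "\<lambda>j. card (B j)" .
  define f where "f A = map blk (sorted_elems A)" for A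
  have words: "f ` {A. A \<subseteq> E \<and> finite A \<and> card A = n} = {y \<in> words. length y = n}" for n
  proof (intro subset_antisym subsetI)
    fix y assume "y \<in> f ` {A. A \<subseteq> E \<and> finite A \<and> card A = n}"
    then obtain A where A: "finite A" "A \<subseteq> E" "card A = n" "y = f A" by blast
    have "count (mset y) j \<le> card (B j)" if "finite (B j)" for j
      unfolding A(4) f_def card_sorted_elems_fibre[OF A(1,2)] using that A(2)
      by (intro card_mono) (auto simp: B_def)
    moreover have "set y \<subseteq> {..<m}" using A blk sorted_elems(2)[OF A(1,2)] by (auto simp: f_def)
    moreover have "length y = n" using A sorted_elems(4)[OF A(1,2)] by (simp add: f_def)
    ultimately show "y \<in> {y \<in> words. length y = n}"
      using srt[OF A(1,2)] A(4) unfolding words_def f_def by blast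
  next
    fix y assume y: "y \<in> {y \<in> words. length y = n}"
    have "\<exists>D. D \<subseteq> B j \<and> finite D \<and> card D = count (mset y) j" for j
    proof (cases "finite (B j)")
      case True
      then have "count (mset y) j \<le> card (B j)" using y by (simp add: words_def)
      then show ?thesis using obtain_subset_with_card_n by metis
    next
      case False
      then show ?thesis using infinite_arbitrarily_large by metis
    qed
    then obtain D where D: "\<And>j. D j \<subseteq> B j" "\<And>j. finite (D j)" "\<And>j. card (D j) = count (mset y) j"
      by metis
    define A where "A = (\<Union>j<m. D j)"
    have A: "finite A" "A \<subseteq> E" using D by (auto simp: A_def B_def)
    have "count (mset (f A)) j = count (mset y) j" for j
    proof (cases "j < m")
      case True
      then have "{x \<in> A. blk x = j} = D j" using D(1) by (auto simp: A_def B_def)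
      then show ?thesis unfolding f_def card_sorted_elems_fibre[OF A] using D(3) by simp
    next
      case False
      have "{x \<in> A. blk x = j} = {}" using False A(2) blk by auto
      moreover have "j \<notin> set y" using False y by (auto simp: words_def)
      then have "count (mset y) j = 0" by (simp add: count_eq_zero_iff)
      ultimately show ?thesis unfolding f_def card_sorted_elems_fibre[OF A] by (simp only: card.empty)
    qed
    then have "mset (f A) = mset y" by (rule multiset_eqI)
    then have fA: "f A = y"
      using srt[OF A] y by (intro sorted_mset_unique) (auto simp: f_def words_def)
    then have "card A = n" using y sorted_elems(4)[OF A] by (auto simp: f_def)
    then show "y \<in> f ` {A. A \<subseteq> E \<and> finite A \<and> card A = n}" using A fA by blast
  qed
  have codes: "code A = code A' \<longleftrightarrow> eqv (f A) (f A')"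
    if n: "2 \<le> n" and A: "A \<subseteq> E" "finite A" "card A = n" and A': "A' \<subseteq> E" "finite A'" "card A' = n" for n A A'
  proof -
    let ?x = "sorted_elems A" and ?x' = "sorted_elems A'"
    have len: "length ?x = n" "length ?x' = n" using sorted_elems(4) A A' by auto
    have nth: "?x ! i \<in> E" "?x' ! i \<in> E" if "i < n" for i
      using sorted_elems(2)[OF A(2,1)] sorted_elems(2)[OF A'(2,1)] len that A A' by (metis nth_mem subsetD)+
    have lt: "?x ! i \<lhd> ?x ! j" "?x' ! i \<lhd> ?x' ! j" if "i < j" "j < n" for i j
      using sorted_elems(1)[OF A(2,1)] sorted_elems(1)[OF A'(2,1)] len that
      by (auto intro: sorted_wrt_nth_less)
    have pair: "c (?x ! i) (?x ! j) = col (f A ! i) (f A ! j)"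
      "c (?x' ! i) (?x' ! j) = col (f A' ! i) (f A' ! j)" if "i < j" "j < n" for i j
      using col[OF nth(1) nth(1) lt(1)] col[OF nth(2) nth(2) lt(2)] that len by (auto simp: f_def)
    have "code A = code A' \<longleftrightarrow> (\<forall>i<n. \<forall>j<n. c (?x ! i) (?x ! j) = c (?x' ! i) (?x' ! j))"
      using code_eq_iff A A' by metis
    also have "\<dots> \<longleftrightarrow> (\<forall>j<n. \<forall>i<j. c (?x ! i) (?x ! j) = c (?x' ! i) (?x' ! j))" (is "_ \<longleftrightarrow> ?R")
    proof (intro iffI allI impI)
      fix i j assume R: ?R and ij: "i < n" "j < n"
      have lt: "c (?x ! i) (?x ! j) = c (?x' ! i) (?x' ! j)" if "i \<noteq> j" "i < n" "j < n" for i j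
        using R that color_swap[of "?x ! j" "?x ! i" "?x' ! j" "?x' ! i"] by (metis linorder_neqE_nat)
      \<comment> \<open>Equivalence of words only sees pairs of distinct positions; a second
        position, available as \<open>n \<ge> 2\<close>, recovers the diagonal colours.\<close>
      obtain k where "k < n" "k \<noteq> i" using n by (metis One_nat_def less_2_cases_iff less_le_trans zero_neq_one)
      then show "c (?x ! i) (?x ! j) = c (?x' ! i) (?x' ! j)"
        using lt[of i j] color_diag[OF lt[of i k]] ij by (cases "i = j") auto
    qed auto
    also have "\<dots> \<longleftrightarrow> eqv (f A) (f A')"
      using pair len by (auto simp: eqv_iff_nth f_def)
    finally show ?thesis .
  qed
  show ?thesis
  proof (rule eventually_poly_cong[OF eventually_poly_card_leaders])
    fix n :: nat assume "2 \<le> n"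
    then show "card (code ` {A. A \<subseteq> E \<and> finite A \<and> card A = n}) = card {y. leader y \<and> length y = n}"
      by (intro card_codes_eq_card_leaders[OF words] codes) auto
  qed
qed

text \<open>The intersection sizes determine the sorted block word and hence all off-diagonal
  colours; \<open>twins_diag\<close> supplies the diagonal ones.\<close>

lemma finite_twins_monomorphic:
  assumes fin: "finite (E // twins)" and inf: "infinite E"
    and A: "finite A" "A \<subseteq> E" and A': "finite A'" "A' \<subseteq> E"
    and same: "\<And>C. C \<in> E // twins \<Longrightarrow> card (A \<inter> C) = card (A' \<inter> C)"
  shows "code A = code A'"
proof -
  obtain blk :: "'a \<Rightarrow> nat" and m and col
    where blk: "\<And>x. x \<in> E \<Longrightarrow> blk x < m"
    and twins: "\<And>x y. x \<in> E \<Longrightarrow> y \<in> E \<Longrightarrow> blk x = blk y \<longleftrightarrow> (x, y) \<in> twins"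
    and srt: "\<And>A. finite A \<Longrightarrow> A \<subseteq> E \<Longrightarrow> sorted (map blk (sorted_elems A))"
    and col: "\<And>x y. x \<in> E \<Longrightarrow> y \<in> E \<Longrightarrow> x \<lhd> y \<Longrightarrow> c x y = col (blk x) (blk y)"
    by (rule finite_twins_coloring[OF fin]) (rule that)
  let ?x = "sorted_elems A" and ?x' = "sorted_elems A'"
  have "card {x \<in> A. blk x = j} = card {x \<in> A'. blk x = j}" for j
  proof (cases "\<exists>y\<in>E. blk y = j")
    case True
    then obtain y where y: "y \<in> E" "blk y = j" by blast
    then have "{x \<in> D. blk x = j} = D \<inter> twins `` {y}" if "D \<subseteq> E" for D
      using that twins[OF y(1)] by (auto simp: eq_commute[of j])
    then show ?thesis using same[OF quotientI[OF y(1)]] A A' by simp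
  next
    case False
    then have "{x \<in> A. blk x = j} = {}" "{x \<in> A'. blk x = j} = {}" using A A' by auto
    then show ?thesis by (simp only:)
  qed
  then have "count (mset (map blk ?x)) j = count (mset (map blk ?x')) j" for j
    unfolding card_sorted_elems_fibre[OF A] card_sorted_elems_fibre[OF A'] .
  then have "mset (map blk ?x) = mset (map blk ?x')" by (rule multiset_eqI)
  then have eq: "map blk ?x = map blk ?x'"
    by (rule sorted_mset_unique[OF srt[OF A] srt[OF A']])
  then have len: "card A = card A'"
    using sorted_elems(4)[OF A] sorted_elems(4)[OF A'] by (metis length_map)
  have blk_eq: "blk (?x ! i) = blk (?x' ! i)" if "i < card A" for i
    using arg_cong[OF eq, of "\<lambda>l. l ! i"] that len sorted_elems(4)[OF A] sorted_elems(4)[OF A'] by simp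
  have nth: "?x ! i \<in> E" "?x' ! i \<in> E" if "i < card A" for i
    using sorted_elems[OF A] sorted_elems[OF A'] len that A A' by (metis nth_mem subsetD)+
  have lt: "?x ! i \<lhd> ?x ! j" "?x' ! i \<lhd> ?x' ! j" if "i < j" "j < card A" for i j
    using sorted_elems[OF A] sorted_elems[OF A'] len that by (auto intro: sorted_wrt_nth_less)
  have less: "c (?x ! i) (?x ! j) = c (?x' ! i) (?x' ! j)" if "i < j" "j < card A" for i j
    using col[OF nth(1) nth(1) lt(1)] col[OF nth(2) nth(2) lt(2)] blk_eq that by auto
  have "c (?x ! i) (?x ! j) = c (?x' ! i) (?x' ! j)" if "i < card A" "j < card A" for i j
  proof -
    consider "i < j" | "j < i" | "i = j" by linarith
    then show ?thesis
    proof cases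
      case 3
      then show ?thesis using twins_diag[OF inf] twins[OF nth(1) nth(2)] blk_eq that by blast
    qed (use less that color_swap in blast)+
  qed
  then show ?thesis using code_eq_iff[OF A A'] len by blast
qed

section \<open>Lower and upper bounds for the number of codes\<close>

lemma exponential_family_card_codes:
  assumes "exponential_family n"
  shows "2 ^ (n div 3) \<le> card (code ` {A. A \<subseteq> E \<and> finite A \<and> card A = n})"
proof -
  obtain \<A> where \<A>: "\<A> \<subseteq> {A. A \<subseteq> E \<and> finite A \<and> card A = n}" "card \<A> = 2 ^ (n div 3)"
    "\<And>A B. A \<in> \<A> \<Longrightarrow> B \<in> \<A> \<Longrightarrow> iso A B \<Longrightarrow> A = B"
    using assms unfolding exponential_family_def by blast
  have "inj_on code \<A>"
  proof (rule inj_onI)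
    fix A B assume AB: "A \<in> \<A>" "B \<in> \<A>" "code A = code B"
    then have "iso A B" using \<A>(1) iso_iff_code[of A B] by blast
    then show "A = B" using \<A>(3) AB by blast
  qed
  then have "2 ^ (n div 3) = card (code ` \<A>)" using \<A>(2) by (simp add: card_image)
  also have "\<dots> \<le> card (code ` {A. A \<subseteq> E \<and> finite A \<and> card A = n})"
    using \<A>(1) finite_codes by (intro card_mono image_mono)
  finally show ?thesis .
qed

text \<open>The code factors through the vector of intersection sizes, and each of its
  \<open>card P\<close> entries is at most \<open>n\<close>.\<close>

lemma card_codes_le_power:
  assumes "finite P"
    and "\<And>A A'. finite A \<Longrightarrow> A \<subseteq> E \<Longrightarrow> finite A' \<Longrightarrow> A' \<subseteq> E \<Longrightarrow>
      (\<And>B. B \<in> P \<Longrightarrow> card (A \<inter> B) = card (A' \<inter> B)) \<Longrightarrow> code A = code A'"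
  shows "card (code ` {A. A \<subseteq> E \<and> finite A \<and> card A = n}) \<le> (n + 1) ^ card P"
proof -
  let ?S = "{A. A \<subseteq> E \<and> finite A \<and> card A = n}"
  define F where "F A = restrict (\<lambda>B. card (A \<inter> B)) P" for A :: "'a set"
  have "code A = code (inv_into ?S F (F A))" if "A \<in> ?S" for A
  proof -
    let ?A = "inv_into ?S F (F A)"
    have "F A \<in> F ` ?S" using that by (rule imageI)
    then have A: "?A \<in> ?S" "F ?A = F A" by (rule inv_into_into, rule f_inv_into_f)
    have "card (A \<inter> B) = card (?A \<inter> B)" if "B \<in> P" for B
      using fun_cong[OF A(2), of B] that by (simp add: F_def)
    then show ?thesis using that A(1) by (intro assms(2)) auto
  qed
  then have img: "code ` ?S = (\<lambda>y. code (inv_into ?S F y)) ` F ` ?S" by (force simp: image_image)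
  have sub: "F ` ?S \<subseteq> P \<rightarrow>\<^sub>E {..n}" by (auto simp: F_def card_mono)
  have finP: "finite (P \<rightarrow>\<^sub>E {..n})" using assms(1) by (intro finite_PiE) auto
  have "card (code ` ?S) \<le> card (F ` ?S)"
    unfolding img by (rule card_image_le[OF finite_subset[OF sub finP]])
  also have "\<dots> \<le> card (P \<rightarrow>\<^sub>E {..n})" using sub finP by (rule card_mono[rotated])
  also have "\<dots> = (n + 1) ^ card P" using assms(1) by (simp add: card_PiE)
  finally show ?thesis .
qed

end

section \<open>Ordered binary structures\<close>

lemma card_image_cong_kernel:
  assumes "\<And>a b. a \<in> S \<Longrightarrow> b \<in> S \<Longrightarrow> f a = f b \<longleftrightarrow> g a = g b"
  shows "card (f ` S) = card (g ` S)"
proof (rule bij_betw_same_card[of "\<lambda>y. g (inv_into S f y)"])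
  have h: "g (inv_into S f (f a)) = g a" if a: "a \<in> S" for a
  proof -
    have "f a \<in> f ` S" using a by (rule imageI)
    then show ?thesis
      using assms[of "inv_into S f (f a)" a] a inv_into_into[of "f a" f S] f_inv_into_f[of "f a" f S] by blast
  qed
  show "bij_betw (\<lambda>y. g (inv_into S f y)) (f ` S) (g ` S)"
    unfolding bij_betw_def inj_on_def using h assms by (simp add: image_image)
qed

text \<open>Otherwise \<open>x ^ d / exp x\<close> at \<open>x = n * ln 2\<close> would stay bounded
  away from 0. The base \<open>3 * n + 1\<close> arises from evaluating the profile bounds at
  \<open>3 * n\<close>.\<close>

lemma ex_power_less_two_power: "\<exists>n :: nat. (3 * n + 1) ^ d < 2 ^ n"
proof (rule ccontr)
  assume "\<not> ?thesis"
  then have le: "(2 :: nat) ^ n \<le> (3 * n + 1) ^ d" for n by (simp add: not_less)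
  \<comment> \<open>Chosen so that \<open>(4 * n) ^ d\<close> equals
    \<open>K * (n * ln 2) ^ d\<close>.\<close>
  define K where "K = (4 / ln 2 :: real) ^ d"
  have ge: "1 \<le> K * ((real n * ln 2) ^ d / exp (real n * ln 2))" if "1 \<le> n" for n
  proof -
    have "exp (real n * ln 2) = real (2 ^ n)"
      by (simp add: exp_of_nat_mult)
    also have "\<dots> \<le> real ((3 * n + 1) ^ d)" using le of_nat_mono by blast
    also have "\<dots> = (3 * real n + 1) ^ d" by (simp add: add.commute)
    also have "\<dots> \<le> (4 * real n) ^ d" by (rule power_mono) (use that in auto)
    also have "\<dots> = K * (real n * ln 2) ^ d" unfolding K_def power_mult_distrib[symmetric] by simp
    finally have "1 \<le> K * (real n * ln 2) ^ d / exp (real n * ln 2)"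
      by (subst le_divide_eq_1_pos) simp_all
    then show ?thesis by (simp only: times_divide_eq_right)
  qed
  have lim: "((\<lambda>n. K * ((real n * ln 2) ^ d / exp (real n * ln 2))) \<longlongrightarrow> K * 0) sequentially"
    by (intro tendsto_mult tendsto_const filterlim_compose[OF tendsto_power_div_exp_0]
        filterlim_at_top_mult_tendsto_pos[OF tendsto_const] filterlim_real_sequentially) simp
  have "(1 :: real) \<le> K * 0"
    by (rule tendsto_lowerbound[OF lim eventually_sequentiallyI[of 1]]) (use ge in simp_all)
  then show False by simp
qed

section \<open>Translating structures into coloured orders\<close>

definition strict_leq :: "'a binary_structure \<Rightarrow> 'a \<Rightarrow> 'a \<Rightarrow> bool" where
  "strict_leq R x y \<longleftrightarrow> (x, y) \<in> leq R \<and> x \<noteq> y"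

definition edge_color :: "'a binary_structure \<Rightarrow> 'a \<Rightarrow> 'a \<Rightarrow> bool list" where
  "edge_color R x y = map (\<lambda>r. (x, y) \<in> r) (rels R)"

text \<open>
  The colour of a pair also records the loops at both points, so that it determines the colours of
  the reversed pair and of the two diagonal pairs.
\<close>

definition pair_color :: "'a binary_structure \<Rightarrow> 'a \<Rightarrow> 'a \<Rightarrow> bool list \<times> bool list \<times> bool list \<times> bool list" where
  "pair_color R x y = (edge_color R x x, edge_color R x y, edge_color R y x, edge_color R y y)"

lemma edge_color_eq_iff: "edge_color R x y = edge_color R x' y' \<longleftrightarrow>
    (\<forall>i<length (rels R). (x, y) \<in> rels R ! i \<longleftrightarrow> (x', y') \<in> rels R ! i)"
  by (auto simp: edge_color_def list_eq_iff_nth_eq)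

lemma colored_order_structure:
  assumes "ordered_binary_structure k R"
  shows "colored_order (base R) (strict_leq R) (pair_color R)"
proof
  have lin: "linear_order_on (base R) (leq R)" using assms by (simp add: ordered_binary_structure_def)
  then have tr: "trans (leq R)" and an: "antisym (leq R)" and tot: "total_on (base R) (leq R)"
    by (auto simp: order_on_defs)
  show "\<not> strict_leq R x x" for x by (simp add: strict_leq_def)
  show "strict_leq R x z" if "strict_leq R x y" "strict_leq R y z" for x y z
    using that tr an unfolding strict_leq_def by (metis antisymD transD)
  show "strict_leq R x y \<or> strict_leq R y x" if "x \<in> base R" "y \<in> base R" "x \<noteq> y" for x y
    using that tot unfolding strict_leq_def by (auto simp: total_on_def)
  show "pair_color R y x = pair_color R y' x'" if "pair_color R x y = pair_color R x' y'" for x y x' y'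
    using that by (simp add: pair_color_def)
  show "pair_color R x x = pair_color R x' x'" if "pair_color R x y = pair_color R x' y'" for x y x' y'
    using that by (simp add: pair_color_def)
  let ?L = "{l :: bool list. set l \<subseteq> UNIV \<and> length l = length (rels R)}"
  have "finite ?L" by (rule finite_lists_length_eq) simp
  then have "finite (?L \<times> ?L \<times> ?L \<times> ?L)" by (intro finite_cartesian_product)
  moreover have "range (case_prod (pair_color R)) \<subseteq> ?L \<times> ?L \<times> ?L \<times> ?L"
    by (auto simp: pair_color_def edge_color_def)
  ultimately show "finite (range (case_prod (pair_color R)))" by (rule finite_subset[rotated])
qed

lemma isomorphic_iff_iso:
  assumes R: "ordered_binary_structure k R" and A: "A \<subseteq> base R" "B \<subseteq> base R"
  shows "isomorphic (restriction R A) (restriction R B) \<longleftrightarrow>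
    colored_order.iso (strict_leq R) (pair_color R) A B"
proof -
  interpret colored_order "base R" "strict_leq R" "pair_color R" using R by (rule colored_order_structure)
  have leq_refl: "(x, x) \<in> leq R" if "x \<in> base R" for x
    using R that by (auto simp: ordered_binary_structure_def order_on_defs refl_on_def)
  have base: "base (restriction R A) = A" "base (restriction R B) = B"
    using A by (auto simp: restriction_def)
  have *: "(\<forall>x\<in>A. \<forall>y\<in>A. ((x, y) \<in> leq (restriction R A) \<longleftrightarrow> (f x, f y) \<in> leq (restriction R B)) \<and>
      (\<forall>i<length (rels (restriction R A)).
        (x, y) \<in> rels (restriction R A) ! i \<longleftrightarrow> (f x, f y) \<in> rels (restriction R B) ! i))
    \<longleftrightarrow> (\<forall>x\<in>A. \<forall>y\<in>A. (strict_leq R x y \<longleftrightarrow> strict_leq R (f x) (f y)) \<and> pair_color R x y = pair_color R (f x) (f y))"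
    (is "?L \<longleftrightarrow> ?R") if f: "bij_betw f A B" for f
  proof -
    have mem: "f x \<in> B" if "x \<in> A" for x using f that by (rule bij_betwE[rule_format])
    have inj: "f x = f y \<longleftrightarrow> x = y" if "x \<in> A" "y \<in> A" for x y
      using f that by (auto simp: bij_betw_def inj_on_def)
    have le_iff: "((x, y) \<in> leq R \<longleftrightarrow> (f x, f y) \<in> leq R) \<longleftrightarrow> (strict_leq R x y \<longleftrightarrow> strict_leq R (f x) (f y))"
      if "x \<in> A" "y \<in> A" for x y
    proof (cases "x = y")
      case True
      have "x \<in> base R" "f x \<in> base R" using A mem that by blast+
      then show ?thesis using True leq_refl by (simp add: strict_leq_def)
    next
      case False
      then show ?thesis using inj[OF that] by (simp add: strict_leq_def)
    qed
    have "?L \<longleftrightarrow> (\<forall>x\<in>A. \<forall>y\<in>A. ((x, y) \<in> leq R \<longleftrightarrow> (f x, f y) \<in> leq R) \<and> edge_color R x y = edge_color R (f x) (f y))"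
      using mem by (simp add: restriction_def edge_color_eq_iff)
    also have "\<dots> \<longleftrightarrow> (\<forall>x\<in>A. \<forall>y\<in>A. (strict_leq R x y \<longleftrightarrow> strict_leq R (f x) (f y)) \<and> edge_color R x y = edge_color R (f x) (f y))"
      using le_iff by blast
    also have "\<dots> \<longleftrightarrow> ?R" by (auto simp: pair_color_def)
    finally show ?thesis .
  qed
  have "length (rels (restriction R A)) = length (rels (restriction R B))"
    by (simp add: restriction_def)
  then have "isomorphic (restriction R A) (restriction R B) \<longleftrightarrow> (\<exists>f. bij_betw f A B \<and>
      (\<forall>x\<in>A. \<forall>y\<in>A. ((x, y) \<in> leq (restriction R A) \<longleftrightarrow> (f x, f y) \<in> leq (restriction R B)) \<and>
      (\<forall>i<length (rels (restriction R A)).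
        (x, y) \<in> rels (restriction R A) ! i \<longleftrightarrow> (f x, f y) \<in> rels (restriction R B) ! i)))"
    unfolding isomorphic_def base by blast
  also have "\<dots> \<longleftrightarrow> iso A B"
    unfolding iso_def by (rule iff_exI, rule conj_cong[OF refl], rule *)
  finally show ?thesis .
qed

text \<open>Members of the age are isomorphism classes of restrictions, and two of these classes
  coincide exactly when the codes of the underlying sets do.\<close>

lemma profile_eq_card_codes:
  assumes R: "ordered_binary_structure k R"
  shows "profile R n = card (colored_order.code (strict_leq R) (pair_color R) `
    {A. A \<subseteq> base R \<and> finite A \<and> card A = n})"
proof -
  interpret colored_order "base R" "strict_leq R" "pair_color R" using R by (rule colored_order_structure)
  let ?S = "{A. A \<subseteq> base R \<and> finite A \<and> card A = n}"
  define rel where "rel = {(S, T). S \<in> finite_restrictions R \<and> T \<in> finite_restrictions R \<and> isomorphic S T}"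
  define cls where "cls A = rel `` {restriction R A}" for A
  have code: "isomorphic (restriction R A) (restriction R B) \<longleftrightarrow> code A = code B"
    if "A \<subseteq> base R" "finite A" "B \<subseteq> base R" "finite B" for A B
    using isomorphic_iff_iso[OF R that(1,3)] iso_iff_code that by blast
  have cls: "cls A = {restriction R B | B. B \<subseteq> base R \<and> finite B \<and> code A = code B}"
    if "A \<subseteq> base R" "finite A" for A
    using code[OF that] that unfolding cls_def rel_def finite_restrictions_def by blast
  have base: "base (restriction R B) = B" if "B \<subseteq> base R" for B
    using that by (auto simp: restriction_def)
  have card_eq: "card A = card B"
    if "code A = code B" "A \<subseteq> base R" "finite A" "B \<subseteq> base R" "finite B" for A B
    using that code_eq_iff by blast
  have "{C \<in> age R. \<forall>S\<in>C. card (base S) = n} = cls ` ?S"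
  proof (intro subset_antisym subsetI)
    fix C assume "C \<in> {C \<in> age R. \<forall>S\<in>C. card (base S) = n}"
    then have C: "C \<in> finite_restrictions R // rel" "\<forall>S\<in>C. card (base S) = n"
      by (auto simp: age_def rel_def)
    then obtain A where A: "A \<subseteq> base R" "finite A" "C = cls A"
      unfolding quotient_def finite_restrictions_def cls_def by blast
    then have "restriction R A \<in> C" using cls[OF A(1,2)] by blast
    then have "card A = n" using C(2) base[OF A(1)] by auto
    then show "C \<in> cls ` ?S" using A by blast
  next
    fix C assume "C \<in> cls ` ?S"
    then obtain A where A: "A \<subseteq> base R" "finite A" "card A = n" "C = cls A" by blast
    then have "C \<in> age R"
      unfolding age_def cls_def quotient_def finite_restrictions_def rel_def by blast
    moreover have "card (base S) = n" if S: "S \<in> C" for S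
    proof -
      obtain B where B: "S = restriction R B" "B \<subseteq> base R" "finite B" "code A = code B"
        using S unfolding A(4) cls[OF A(1,2)] by blast
      then show ?thesis using card_eq[OF B(4) A(1,2) B(2,3)] A(3) base[OF B(2)] by simp
    qed
    ultimately show "C \<in> {C \<in> age R. \<forall>S\<in>C. card (base S) = n}" by blast
  qed
  moreover have "card (cls ` ?S) = card (code ` ?S)"
  proof (rule card_image_cong_kernel)
    fix A B assume A: "A \<in> ?S" and B: "B \<in> ?S"
    show "cls A = cls B \<longleftrightarrow> code A = code B"
    proof
      assume eq: "cls A = cls B"
      have "restriction R A \<in> cls A" using cls[of A] A by blast
      then obtain A' where "restriction R A = restriction R A'" "A' \<subseteq> base R" "code B = code A'"
        unfolding eq using cls[of B] B by blast
      then show "code A = code B" using base[of A] base[of A'] A by simp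
    qed (use cls A B in simp)
  qed
  ultimately show ?thesis by (simp add: profile_def)
qed

theorem theorem8p29:
  fixes R :: "'a binary_structure" and k :: nat
  assumes "ordered_binary_structure k R"
  shows
    "((\<exists>P. monomorphic_decomposition R P \<and> finite P) \<longrightarrow>
        (\<exists>p :: real poly. \<forall>\<^sub>F n in sequentially. real (profile R n) = poly p (real n)))
     \<and>
     (\<not> (\<exists>P. monomorphic_decomposition R P \<and> finite P) \<longrightarrow>
        (\<exists>(a::real) (c::real). a > 0 \<and> c > 1 \<and>
          (\<forall>\<^sub>F n in sequentially. real (profile R n) \<ge> a * c ^ n)))"
proof -
  interpret colored_order "base R" "strict_leq R" "pair_color R" using assms by (rule colored_order_structure)
  note profile = profile_eq_card_codes[OF assms]
  have code: "isomorphic (restriction R A) (restriction R B) \<longleftrightarrow> code A = code B"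
    if "A \<subseteq> base R" "finite A" "B \<subseteq> base R" "finite B" for A B
    using isomorphic_iff_iso[OF assms that(1,3)] iso_iff_code that by blast
  have lower: "2 ^ (n div 3) \<le> profile R n" if "infinite (base R // twins)" for n
    unfolding profile by (intro exponential_family_card_codes infinite_twins_exponential that)
  have poly: "\<exists>p :: real poly. \<forall>\<^sub>F n in sequentially. real (profile R n) = poly p (real n)"
    if P: "monomorphic_decomposition R P" "finite P" for P
  proof -
    have upper: "profile R n \<le> (n + 1) ^ card P" for n
      unfolding profile
    proof (rule card_codes_le_power[OF P(2)])
      fix A A' assume A: "finite A" "A \<subseteq> base R" "finite A'" "A' \<subseteq> base R"
        and eq: "\<And>B. B \<in> P \<Longrightarrow> card (A \<inter> B) = card (A' \<inter> B)"
      then have "isomorphic (restriction R A) (restriction R A')"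
        using P(1) unfolding monomorphic_decomposition_def by blast
      then show "code A = code A'" using code[OF A(2,1,4,3)] by blast
    qed
    \<comment> \<open>Infinitely many twin classes would put an exponential lower bound below the
      polynomial upper bound.\<close>
    have "finite (base R // twins)"
    proof (rule ccontr)
      assume "infinite (base R // twins)"
      then have "2 ^ (n div 3) \<le> (n + 1) ^ card P" for n
        using lower upper order_trans by blast
      then have "2 ^ n \<le> (3 * n + 1) ^ card P" for n
        by (metis nonzero_mult_div_cancel_left zero_neq_numeral)
      then show False using ex_power_less_two_power[of "card P"] by (metis leD)
    qed
    then have "eventually_poly (profile R)"
      unfolding profile[abs_def] by (rule finite_twins_eventually_poly)
    then show ?thesis by (simp add: eventually_poly_def)
  qed
  have exponential: "\<exists>(a::real) (c::real). a > 0 \<and> c > 1 \<and>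
      (\<forall>\<^sub>F n in sequentially. real (profile R n) \<ge> a * c ^ n)"
    if no: "\<not> (\<exists>P. monomorphic_decomposition R P \<and> finite P)"
  proof -
    \<comment> \<open>A finite base is decomposed by its singletons, since equal intersection sizes
      then force equal sets.\<close>
    have inf: "infinite (base R)"
    proof
      assume fin: "finite (base R)"
      let ?P = "(\<lambda>x. {x}) ` base R"
      have "A = A'"
        if A: "A \<subseteq> base R" "A' \<subseteq> base R" and eq: "\<forall>B\<in>?P. card (A \<inter> B) = card (A' \<inter> B)" for A A'
      proof -
        have "x \<in> A \<longleftrightarrow> x \<in> A'" if "x \<in> base R" for x
        proof -
          have "card (A \<inter> {x}) = card (A' \<inter> {x})" using that eq by blast
          then show ?thesis by (cases "x \<in> A"; cases "x \<in> A'") auto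
        qed
        then show ?thesis using A by blast
      qed
      moreover have "partition_on (base R) ?P"
        by (auto simp: partition_on_def disjoint_def)
      moreover have "isomorphic (restriction R A) (restriction R A)" if "finite A" "A \<subseteq> base R" for A
        using code[OF that(2,1) that(2,1)] by blast
      ultimately have "monomorphic_decomposition R ?P"
        unfolding monomorphic_decomposition_def by metis
      then show False using no fin by blast
    qed
    have "infinite (base R // twins)"
    proof
      assume fin: "finite (base R // twins)"
      have "monomorphic_decomposition R (base R // twins)"
        unfolding monomorphic_decomposition_def
      proof (intro conjI allI impI)
        show "partition_on (base R) (base R // twins)"
          using twins_equiv by (rule partition_on_quotient)
        fix A A' assume A: "finite A" "finite A'" "A \<subseteq> base R" "A' \<subseteq> base R"
          and eq: "\<forall>B\<in>base R // twins. card (A \<inter> B) = card (A' \<inter> B)"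
        have "code A = code A'"
          using finite_twins_monomorphic[OF fin inf A(1,3,2,4)] eq by blast
        then show "isomorphic (restriction R A) (restriction R A')"
          using code[OF A(3,1,4,2)] by blast
      qed
      then show False using no fin by blast
    qed
    note low = lower[OF this]
    have "1 / 2 * (2 powr (1 / 3)) ^ n \<le> real (profile R n)" for n
    proof -
      \<comment> \<open>Rounding gives \<open>n div 3 \<ge> n / 3 - 1\<close>, which costs the
        factor 1/2.\<close>
      have "1 / 2 * (2 powr (1 / 3)) ^ n = 2 powr (real n / 3 - 1)"
        by (simp add: powr_diff powr_power)
      also have "\<dots> \<le> 2 powr real (n div 3)"
        by (intro powr_mono) linarith+
      also have "\<dots> = real (2 ^ (n div 3))" by (simp add: powr_realpow)
      also have "\<dots> \<le> real (profile R n)" using low[of n] by (rule of_nat_mono)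
      finally show ?thesis .
    qed
    moreover have "(2 :: real) powr (1 / 3) > 1" by simp
    ultimately show ?thesis by (intro exI[of _ "1 / 2"] exI[of _ "2 powr (1 / 3)"]) simp
  qed
  show ?thesis using poly exponential by blast
qed

end
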